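(* Let $S$ be the set of all $2$-element subsets of $\{0,1,2,3,4,5\}$ (so $|S|=15$; write $ab$ for $\{a,b\}$) and $T=\{0,1,2,3,4,5\}$. Let $E_1=\{(e,v)\in S\times T: v\in e\}$ be the incidence graph of $K_6$ (so $|E_1|=30$), and let $$\begin{aligned} E_2=\{&(01,2;35,4),\ (01,3;45,2),\ (02,1;34,5),\ (02,3;14,5),\\ &(04,3;15,2),\ (04,5;12,3),\ (05,3;24,1),\ (05,4;23,1),\\ &(13,0;24,5),\ (14,2;35,0),\ (15,4;23,0),\ (25,1;34,0),\\ &(03,5;25,4),\ (13,2;03,4)\}. \end{aligned}$$ Then the augmented bipartite graph $G=(S,T,E_1\cup E_2)$ is weak admissible. Consequently, $$z_{wL}(15,6)\ge |E_1|+|E_2|=30+14=44,$$ and hence $\mathrm{BSR}(15,6)\ge 44$.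
   Context: Notation: an $m\times n$ biquadratic form is a real polynomial $P(\mathbf{x},\mathbf{y})=\sum_{i,k=1}^m\sum_{j,l=1}^n a_{ijkl}x_ix_ky_jy_l$ (with $a_{ijkl}=a_{kjil}=a_{klij}$). It is SOS if $P=\sum_{p=1}^r f_p^2$ with each $f_p$ a real bilinear form in $(\mathbf{x},\mathbf{y})$; the minimum such $r$ is its SOS rank $\mathrm{SOS}(P)$. $\mathrm{BSR}(m,n)$ is the maximum SOS rank among all $m\times n$ SOS biquadratic forms. $z(m,n)$ (the Zarankiewicz number) is the maximum number of edges of an $m\times n$ bipartite graph with no $C_4$. Augmented bipartite graphs $G=(S,T,E_1\cup E_2)$, with $|S|=m$, $|T|=n$ (by default $S=\{1,\dots,m\}$, $T=\{1,\dots,n\}$; other index sets are identified with these by relabelling). A cell is a pair $(i,j)\in S\times T$ ($i$ is its row, $j$ its column). A 1-edge is a cell; $E_1$ is a set of 1-edges, viewed as a bipartite graph $G_1$ on $S,T$. A 2-edge is an unordered pair of distinct cells, written $(i,j;k,l)$; the cells $(i,j)$ and $(k,l)$ are its two halves. It is nondegenerate if $i\ne k$ and $j\ne l$, row-degenerate if $i=k$ and $j\neq l$, column-degenerate if $i\ne k$ and $j=l$. $E_2$ is a set of 2-edges. A cell is occupied if it is in $E_1$ or is a half of some 2-edge in $E_2$; otherwise it is unoccupied. The opposite cells of a nondegenerate 2-edge $(i,j;k,l)$ are $(i,l)$ and $(k,j)$. Two nondegenerate 2-edges of the form $(i,j;k,l)$ and $(i,l;k,j)$ are called complementary. The dependency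 graph $\mathcal{D}$ is the directed graph whose vertices are the nondegenerate 2-edges in $E_2$, with an arc $e\to e'$ ($e\ne e'$) if both opposite cells of $e$ are occupied and one half of $e'$ is an opposite cell of $e$. An edge's row (column) set is the set of rows (columns) of its cell (1-edge) or of its halves (2-edge). Two edges are vertex-disjoint if their row sets are disjoint and their column sets are disjoint (here rows are elements of $S$). The opposite cells of a vertex-disjoint pair $e,f$ are the cells formed by a row of one of the two edges and a column of the other. For a 1-edge $(i,j)$ and a 2-edge $(k,l;p,q)$ they are $(i,l),(i,q),(k,j),(p,j)$. $G$ is weak admissible if it satisfies: (S) No 2-edge shares a cell with any 1-edge or with any other 2-edge. (W1) $G_1$ contains no $C_4$. (W2) $\mathcal{D}$ contains no directed cycle other than 2-cycles formed by a pair of complementary 2-edges (which are allowed). (W2') There is no nondegenerate 2-edge in $E_2$ whose two opposite cells are both 1-edges. (W3) For every vertex-disjoint pair of edges of $G$ at least one of which is a 2-edge, at least one of the opposite cells of the pair is unoccupied. $z_{wL}(m,n)$ is the maximum of $|E_1|+|E_2|$ over all weak admissible $G$ with $|E_1|=z(m,n)$. *)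

theory Defs
  imports Complex_Main "Graph_Theory.Pair_Digraph"
begin

section \<open>Biquadratic forms and SOS rank\<close>

text \<open>
  Real forms are represented by the polynomial functions they induce (faithful, as the reals are
  an infinite field).  Vectors of length m are functions on nat of which only the entries with
  index in \<open>{1..m}\<close> matter.
\<close>

definition biquadratic_form ::
  "nat \<Rightarrow> nat \<Rightarrow> ((nat \<Rightarrow> real) \<Rightarrow> (nat \<Rightarrow> real) \<Rightarrow> real) \<Rightarrow> bool" where
  "biquadratic_form m n P \<longleftrightarrow>
    (\<exists>a :: nat \<Rightarrow> nat \<Rightarrow> nat \<Rightarrow> nat \<Rightarrow> real.
      (\<forall>i\<in>{1..m}. \<forall>j\<in>{1..n}. \<forall>k\<in>{1..m}. \<forall>l\<in>{1..n}.
         a i j k l = a k j i l \<and> a i j k l = a k l i j) \<and>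
      P = (\<lambda>x y. \<Sum>i=1..m. \<Sum>k=1..m. \<Sum>j=1..n. \<Sum>l=1..n.
             a i j k l * x i * x k * y j * y l))"

definition bilinear_form ::
  "nat \<Rightarrow> nat \<Rightarrow> ((nat \<Rightarrow> real) \<Rightarrow> (nat \<Rightarrow> real) \<Rightarrow> real) \<Rightarrow> bool" where
  "bilinear_form m n f \<longleftrightarrow>
    (\<exists>b :: nat \<Rightarrow> nat \<Rightarrow> real. f = (\<lambda>x y. \<Sum>i=1..m. \<Sum>j=1..n. b i j * x i * y j))"

definition sum_of_bilinear_squares ::
  "nat \<Rightarrow> nat \<Rightarrow> nat \<Rightarrow> ((nat \<Rightarrow> real) \<Rightarrow> (nat \<Rightarrow> real) \<Rightarrow> real) \<Rightarrow> bool" where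
  "sum_of_bilinear_squares m n r P \<longleftrightarrow>
    (\<exists>f. (\<forall>p\<in>{1..r}. bilinear_form m n (f p)) \<and> P = (\<lambda>x y. \<Sum>p=1..r. (f p x y)^2))"

definition is_SOS ::
  "nat \<Rightarrow> nat \<Rightarrow> ((nat \<Rightarrow> real) \<Rightarrow> (nat \<Rightarrow> real) \<Rightarrow> real) \<Rightarrow> bool" where
  "is_SOS m n P \<longleftrightarrow> (\<exists>r. sum_of_bilinear_squares m n r P)"

definition SOS_rank ::
  "nat \<Rightarrow> nat \<Rightarrow> ((nat \<Rightarrow> real) \<Rightarrow> (nat \<Rightarrow> real) \<Rightarrow> real) \<Rightarrow> nat" where
  "SOS_rank m n P = (LEAST r. sum_of_bilinear_squares m n r P)"

definition BSR :: "nat \<Rightarrow> nat \<Rightarrow> nat" where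
  "BSR m n = Max {SOS_rank m n P | P. biquadratic_form m n P \<and> is_SOS m n P}"

section \<open>The Zarankiewicz number\<close>

definition C4_free :: "('a \<times> 'b) set \<Rightarrow> bool" where
  "C4_free E \<longleftrightarrow>
    \<not> (\<exists>i k j l. i \<noteq> k \<and> j \<noteq> l \<and> {(i, j), (i, l), (k, j), (k, l)} \<subseteq> E)"

definition zarankiewicz :: "nat \<Rightarrow> nat \<Rightarrow> nat" where
  "zarankiewicz m n = Max {card E | E :: (nat \<times> nat) set. E \<subseteq> {1..m} \<times> {1..n} \<and> C4_free E}"

section \<open>Augmented bipartite graphs\<close>

text \<open>
  A 2-edge \<open>(i,j;k,l)\<close> is the two-element set \<open>{(i,j), (k,l)}\<close> of its halves.
\<close>

definition augmented_bipartite_graph ::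
  "'a set \<Rightarrow> 'b set \<Rightarrow> ('a \<times> 'b) set \<Rightarrow> ('a \<times> 'b) set set \<Rightarrow> bool" where
  "augmented_bipartite_graph S T E1 E2 \<longleftrightarrow>
    finite S \<and> finite T \<and> E1 \<subseteq> S \<times> T \<and> (\<forall>e\<in>E2. e \<subseteq> S \<times> T \<and> card e = 2)"

definition nondegenerate :: "('a \<times> 'b) set \<Rightarrow> bool" where
  "nondegenerate e \<longleftrightarrow> (\<exists>i j k l. e = {(i, j), (k, l)} \<and> i \<noteq> k \<and> j \<noteq> l)"

definition occupied :: "('a \<times> 'b) set \<Rightarrow> ('a \<times> 'b) set set \<Rightarrow> ('a \<times> 'b) set" where
  "occupied E1 E2 = E1 \<union> \<Union>E2"

text \<open>
  For a nondegenerate \<open>e\<close>, naming the halves in either order contributes one of the two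
  opposite cells \<open>(i,l)\<close> and \<open>(k,j)\<close>.
\<close>

definition opposite_cells :: "('a \<times> 'b) set \<Rightarrow> ('a \<times> 'b) set" where
  "opposite_cells e = {(i, l) | i j k l. e = {(i, j), (k, l)}}"

definition complementary :: "('a \<times> 'b) set \<Rightarrow> ('a \<times> 'b) set \<Rightarrow> bool" where
  "complementary e e' \<longleftrightarrow>
    (\<exists>i j k l. i \<noteq> k \<and> j \<noteq> l \<and> e = {(i, j), (k, l)} \<and> e' = {(i, l), (k, j)})"

definition dependency_graph ::
  "('a \<times> 'b) set \<Rightarrow> ('a \<times> 'b) set set \<Rightarrow> ('a \<times> 'b) set pair_pre_digraph" where
  "dependency_graph E1 E2 =
    \<lparr> pverts = {e \<in> E2. nondegenerate e},
      parcs = {(e, e'). e \<in> E2 \<and> nondegenerate e \<and> e' \<in> E2 \<and> nondegenerate e' \<and> e \<noteq> e' \<and>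
                 opposite_cells e \<subseteq> occupied E1 E2 \<and> e' \<inter> opposite_cells e \<noteq> {}} \<rparr>"

text \<open>
  To treat both kinds of edges uniformly, every edge is given by its set of cells, so that a
  1-edge becomes a singleton.
\<close>

definition edges :: "('a \<times> 'b) set \<Rightarrow> ('a \<times> 'b) set set \<Rightarrow> ('a \<times> 'b) set set" where
  "edges E1 E2 = (\<lambda>c. {c}) ` E1 \<union> E2"

definition vertex_disjoint :: "('a \<times> 'b) set \<Rightarrow> ('a \<times> 'b) set \<Rightarrow> bool" where
  "vertex_disjoint e f \<longleftrightarrow> fst ` e \<inter> fst ` f = {} \<and> snd ` e \<inter> snd ` f = {}"

definition pair_opposite_cells :: "('a \<times> 'b) set \<Rightarrow> ('a \<times> 'b) set \<Rightarrow> ('a \<times> 'b) set" where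
  "pair_opposite_cells e f = (fst ` e \<times> snd ` f) \<union> (fst ` f \<times> snd ` e)"

definition cond_S :: "('a \<times> 'b) set \<Rightarrow> ('a \<times> 'b) set set \<Rightarrow> bool" where
  "cond_S E1 E2 \<longleftrightarrow> (\<forall>e\<in>E2. e \<inter> E1 = {} \<and> (\<forall>f\<in>E2. f \<noteq> e \<longrightarrow> e \<inter> f = {}))"

text \<open>
  A cycle \<open>p\<close> is the list of its arcs; in a 2-cycle \<open>[(e,e'), (e',e)]\<close> the two vertices are the
  ends of the first arc.
\<close>

definition cond_W2 :: "('a \<times> 'b) set \<Rightarrow> ('a \<times> 'b) set set \<Rightarrow> bool" where
  "cond_W2 E1 E2 \<longleftrightarrow>
    (\<forall>p. pre_digraph.cycle (with_proj (dependency_graph E1 E2)) p \<longrightarrow>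
       length p = 2 \<and> complementary (fst (hd p)) (snd (hd p)))"

definition cond_W2' :: "('a \<times> 'b) set \<Rightarrow> ('a \<times> 'b) set set \<Rightarrow> bool" where
  "cond_W2' E1 E2 \<longleftrightarrow> \<not> (\<exists>e\<in>E2. nondegenerate e \<and> opposite_cells e \<subseteq> E1)"

definition cond_W3 :: "('a \<times> 'b) set \<Rightarrow> ('a \<times> 'b) set set \<Rightarrow> bool" where
  "cond_W3 E1 E2 \<longleftrightarrow>
    (\<forall>e\<in>E2. \<forall>f\<in>edges E1 E2. vertex_disjoint e f \<longrightarrow>
       (\<exists>c\<in>pair_opposite_cells e f. c \<notin> occupied E1 E2))"

definition weak_admissible ::
  "'a set \<Rightarrow> 'b set \<Rightarrow> ('a \<times> 'b) set \<Rightarrow> ('a \<times> 'b) set set \<Rightarrow> bool" where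
  "weak_admissible S T E1 E2 \<longleftrightarrow>
    augmented_bipartite_graph S T E1 E2 \<and>
    cond_S E1 E2 \<and> C4_free E1 \<and> cond_W2 E1 E2 \<and> cond_W2' E1 E2 \<and> cond_W3 E1 E2"

definition z_wL :: "nat \<Rightarrow> nat \<Rightarrow> nat" where
  "z_wL m n =
    Max {card E1 + card E2 | (E1 :: (nat \<times> nat) set) E2.
           weak_admissible {1..m} {1..n} E1 E2 \<and> card E1 = zarankiewicz m n}"

end

theory Submission
  imports Defs "Graph_Theory.Digraph_Component"
begin

text \<open>
  To a graph attach the form with one square \<open>(\<Sum>(i, j)\<in>e. x\<^sub>i y\<^sub>j)\<^sup>2\<close> per edge \<open>e\<close>.  In any
  representation as a sum of \<open>r\<close> squares, collect the coefficients of \<open>x\<^sub>i y\<^sub>j\<close> into a vector of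
  \<open>\<real>\<^sup>r\<close>.  Comparing coefficients, cells on a common line have the expected inner product, an
  unoccupied cell has the zero vector, and for the remaining pairs only the sum of the inner
  products of the two diagonals of a rectangle is known.  Weak admissibility removes this
  ambiguity: by induction along the dependency graph, which is acyclic up to complementary pairs,
  the two halves of every 2-edge have the same unit vector, and then (W3), (W2') and
  \<open>C\<^sub>4\<close>-freeness make the vectors of distinct edges orthogonal.  So there are at most \<open>r\<close> edges.

  For the graph at hand, \<open>z(15, 6) = 30\<close>: a row with \<open>d\<close> edges contains \<open>d choose 2 \<ge> d - 1\<close>
  pairs of columns, and no pair of columns occurs in two rows.  In (W2) only one 2-edge has both
  opposite cells occupied, so the dependency graph has no directed path with two arcs.
\<close>

section \<open>Sums of squares of bilinear forms\<close>

text \<open>Coefficients are indexed by cells, so that the indicator of an edge is itself a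
  coefficient family.\<close>

definition bilin :: "nat \<Rightarrow> nat \<Rightarrow> (nat \<times> nat \<Rightarrow> real) \<Rightarrow> (nat \<Rightarrow> real) \<Rightarrow> (nat \<Rightarrow> real) \<Rightarrow> real" where
  "bilin m n b x y = (\<Sum>c\<in>{1..m} \<times> {1..n}. b c * x (fst c) * y (snd c))"

lemma bilin_altdef: "bilin m n b x y = (\<Sum>i=1..m. \<Sum>j=1..n. b (i, j) * x i * y j)"
  unfolding bilin_def by (simp add: sum.cartesian_product case_prod_beta)

lemma bilinear_form_bilin: "bilinear_form m n (bilin m n b)"
  unfolding bilinear_form_def bilin_def
  by (intro exI[of _ "\<lambda>i j. b (i, j)"] ext) (simp add: sum.cartesian_product case_prod_beta)

lemma bilinear_form_iff: "bilinear_form m n f \<longleftrightarrow> (\<exists>b. f = bilin m n b)"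
proof
  assume "bilinear_form m n f"
  then obtain b where f: "f = (\<lambda>x y. \<Sum>i=1..m. \<Sum>j=1..n. b i j * x i * y j)"
    unfolding bilinear_form_def by auto
  have "f = bilin m n (\<lambda>(i, j). b i j)"
    unfolding f bilin_def by (intro ext) (simp add: sum.cartesian_product case_prod_beta)
  then show "\<exists>b. f = bilin m n b" by blast
qed (auto simp: bilinear_form_bilin)

lemma bilin_add_left: "bilin m n b (\<lambda>i. x i + x' i) y = bilin m n b x y + bilin m n b x' y"
  and bilin_add_right: "bilin m n b x (\<lambda>j. y j + y' j) = bilin m n b x y + bilin m n b x y'"
  and bilin_diff_left: "bilin m n b (\<lambda>i. x i - x' i) y = bilin m n b x y - bilin m n b x' y"
  and bilin_diff_right: "bilin m n b x (\<lambda>j. y j - y' j) = bilin m n b x y - bilin m n b x y'"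
  by (simp_all add: bilin_def algebra_simps sum.distrib sum_subtractf)

lemma bilin_unit:
  assumes "c \<in> {1..m} \<times> {1..n}"
  shows "bilin m n b (\<lambda>i. of_bool (i = fst c)) (\<lambda>j. of_bool (j = snd c)) = b c"
proof -
  have "bilin m n b (\<lambda>i. of_bool (i = fst c)) (\<lambda>j. of_bool (j = snd c))
      = (\<Sum>d\<in>{1..m} \<times> {1..n}. if d = c then b d else 0)"
    unfolding bilin_def by (intro sum.cong) (auto simp: of_bool_def prod_eq_iff)
  also have "\<dots> = b c" using assms by simp
  finally show ?thesis .
qed

lemma sum_of_bilinear_squares_iff:
  "sum_of_bilinear_squares m n r P \<longleftrightarrow>
    (\<exists>b. P = (\<lambda>x y. \<Sum>p=1..r. (bilin m n (b p) x y)\<^sup>2))"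
proof
  assume "sum_of_bilinear_squares m n r P"
  then obtain f where f: "\<forall>p\<in>{1..r}. bilinear_form m n (f p)"
    and P: "P = (\<lambda>x y. \<Sum>p=1..r. (f p x y)^2)"
    unfolding sum_of_bilinear_squares_def by auto
  from f obtain b where "\<forall>p\<in>{1..r}. f p = bilin m n (b p)"
    unfolding bilinear_form_iff by metis
  then have "P = (\<lambda>x y. \<Sum>p=1..r. (bilin m n (b p) x y)\<^sup>2)"
    unfolding P by auto
  then show "\<exists>b. P = (\<lambda>x y. \<Sum>p=1..r. (bilin m n (b p) x y)\<^sup>2)"
    by (rule exI[of _ b])
next
  assume "\<exists>b. P = (\<lambda>x y. \<Sum>p=1..r. (bilin m n (b p) x y)\<^sup>2)"
  then obtain b where P: "P = (\<lambda>x y. \<Sum>p=1..r. (bilin m n (b p) x y)\<^sup>2)"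
    by (rule exE)
  show "sum_of_bilinear_squares m n r P"
    unfolding sum_of_bilinear_squares_def P
    by (intro exI[of _ "\<lambda>p. bilin m n (b p)"] conjI refl ballI bilinear_form_bilin)
qed

text \<open>Lets the squares be indexed by the edges of a graph, or by list positions, in place of
  \<open>{1..r}\<close>.\<close>

lemma sum_of_bilinear_squares_reindex:
  assumes "finite I" "card I = r"
  shows "sum_of_bilinear_squares m n r (\<lambda>x y. \<Sum>p\<in>I. (bilin m n (b p) x y)\<^sup>2)"
proof -
  obtain h where h: "bij_betw h {1..r} I"
    using assms finite_same_card_bij[of "{1..r}" I] by auto
  show ?thesis
    unfolding sum_of_bilinear_squares_iff
    by (intro exI[of _ "\<lambda>p. b (h p)"] ext) (simp add: sum.reindex_bij_betw[OF h, symmetric])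
qed

text \<open>Coefficients are compared by polarising in both arguments at once.\<close>

lemma gram_eq_if_sum_of_squares_eq:
  assumes eq: "(\<lambda>x y. \<Sum>p\<in>I. (bilin m n (b p) x y)\<^sup>2) = (\<lambda>x y. \<Sum>p\<in>J. (bilin m n (b' p) x y)\<^sup>2)"
    and mem: "i \<in> {1..m}" "k \<in> {1..m}" "j \<in> {1..n}" "l \<in> {1..n}"
  shows "(\<Sum>p\<in>I. b p (i, j) * b p (k, l)) + (\<Sum>p\<in>I. b p (i, l) * b p (k, j))
       = (\<Sum>p\<in>J. b' p (i, j) * b' p (k, l)) + (\<Sum>p\<in>J. b' p (i, l) * b' p (k, j))"
proof -
  define u :: "nat \<Rightarrow> nat \<Rightarrow> real" where "u a = (\<lambda>i. of_bool (i = a))" for a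
  \<comment> \<open>Signed sum over the four choices of signs in
    \<open>(u i \<plusminus> u k, u j \<plusminus> u l)\<close>. A product survives only if it is
    odd in both signs; the cross terms of a square do so four times with factor 2, whence the 8
    below.\<close>
  define D where "D F = F (\<lambda>a. u i a + u k a) (\<lambda>a. u j a + u l a)
      - F (\<lambda>a. u i a + u k a) (\<lambda>a. u j a - u l a)
      - F (\<lambda>a. u i a - u k a) (\<lambda>a. u j a + u l a)
      + F (\<lambda>a. u i a - u k a) (\<lambda>a. u j a - u l a)"
    for F :: "(nat \<Rightarrow> real) \<Rightarrow> (nat \<Rightarrow> real) \<Rightarrow> real"
  have unit: "bilin m n c (u a) (u d) = c (a, d)" if "a \<in> {1..m}" "d \<in> {1..n}" for c a d
    using bilin_unit[of "(a, d)" m n c] that by (simp add: u_def)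
  have D1: "D (\<lambda>x y. (bilin m n c x y)\<^sup>2) = 8 * (c (i, j) * c (k, l) + c (i, l) * c (k, j))" for c
    unfolding D_def bilin_add_left bilin_add_right bilin_diff_left bilin_diff_right
    using mem by (simp add: unit power2_eq_square algebra_simps)
  have D2: "D (\<lambda>x y. \<Sum>p\<in>K. (bilin m n (c p) x y)\<^sup>2)
      = 8 * ((\<Sum>p\<in>K. c p (i, j) * c p (k, l)) + (\<Sum>p\<in>K. c p (i, l) * c p (k, j)))"
    for K :: "'z set" and c
  proof -
    have "D (\<lambda>x y. \<Sum>p\<in>K. (bilin m n (c p) x y)\<^sup>2) = (\<Sum>p\<in>K. D (\<lambda>x y. (bilin m n (c p) x y)\<^sup>2))"
      unfolding D_def by (simp add: sum.distrib sum_subtractf)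
    then show ?thesis
      unfolding D1 by (simp add: sum.distrib sum_distrib_left)
  qed
  show ?thesis
    using arg_cong[OF eq, of D] unfolding D2 by simp
qed

text \<open>The Gram coefficients \<open>Q\<close> are symmetric under exchanging the two cells, but
  not under exchanging the two rows alone. Averaging over the row exchange restores that symmetry
  and leaves the polynomial unchanged.\<close>

lemma biquadratic_form_if_sum_of_bilinear_squares:
  assumes "sum_of_bilinear_squares m n r P"
  shows "biquadratic_form m n P"
proof -
  obtain b where P: "P = (\<lambda>x y. \<Sum>p=1..r. (bilin m n (b p) x y)\<^sup>2)"
    using assms unfolding sum_of_bilinear_squares_iff by (rule exE)
  define Q where "Q i j k l = (\<Sum>p=1..r. b p (i, j) * b p (k, l))" for i j k l
  define q where "q x y i k = (\<Sum>j=1..n. \<Sum>l=1..n. Q i j k l * x i * x k * y j * y l)" for x y i k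
  have P_eq: "P x y = (\<Sum>i=1..m. \<Sum>k=1..m. q x y i k)" for x y
  proof -
    have "P x y = (\<Sum>p=1..r. \<Sum>i=1..m. \<Sum>k=1..m. \<Sum>j=1..n. \<Sum>l=1..n.
        b p (i, j) * b p (k, l) * x i * x k * y j * y l)"
      unfolding P bilin_altdef power2_eq_square sum_product
      by (intro sum.cong refl) (simp add: algebra_simps)
    also have "\<dots> = (\<Sum>i=1..m. \<Sum>k=1..m. \<Sum>j=1..n. \<Sum>l=1..n. \<Sum>p=1..r.
        b p (i, j) * b p (k, l) * x i * x k * y j * y l)"
      \<comment> \<open>Each round moves the sum over \<open>p\<close> one place inwards.\<close>
      by (rule trans[OF sum.swap], rule sum.cong[OF refl])+ (rule refl)
    finally show ?thesis by (simp add: q_def Q_def sum_distrib_right)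
  qed
  have sym: "(\<Sum>j=1..n. \<Sum>l=1..n. (Q i j k l + Q k j i l) / 2 * x i * x k * y j * y l)
      = (q x y i k + q x y k i) / 2" for x y i k
    by (simp add: q_def sum_divide_distrib add_divide_distrib algebra_simps flip: sum.distrib)
  show ?thesis
    unfolding biquadratic_form_def
  proof (intro exI[of _ "\<lambda>i j k l. (Q i j k l + Q k j i l) / 2"] conjI ballI ext)
    fix x y
    have "(\<Sum>i=1..m. \<Sum>k=1..m. q x y k i) = (\<Sum>i=1..m. \<Sum>k=1..m. q x y i k)"
      by (rule sum.swap)
    then show "P x y = (\<Sum>i=1..m. \<Sum>k=1..m. \<Sum>j=1..n. \<Sum>l=1..n.
        (Q i j k l + Q k j i l) / 2 * x i * x k * y j * y l)"
      unfolding sym P_eq by (simp add: sum.distrib flip: sum_divide_distrib)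
  qed (auto simp: Q_def mult.commute)
qed

section \<open>Bounding the SOS rank by elimination\<close>

text \<open>A Givens rotation of two summands makes one of them vanish at a prescribed cell.\<close>

lemma givens:
  fixes f g :: "nat \<times> nat \<Rightarrow> real"
  obtains f' g' where
    "\<And>x y. (bilin m n f x y)\<^sup>2 + (bilin m n g x y)\<^sup>2 = (bilin m n f' x y)\<^sup>2 + (bilin m n g' x y)\<^sup>2"
    "g' c = 0" "\<And>d. f d = 0 \<Longrightarrow> g d = 0 \<Longrightarrow> f' d = 0 \<and> g' d = 0"
proof (cases "f c = 0 \<and> g c = 0")
  case True
  then show ?thesis using that[of f g] by auto
next
  case False
  \<comment> \<open>\<open>C\<close> and \<open>S\<close> are the cosine and sine of the rotation
    that carries \<open>(f c, g c)\<close> to \<open>(s, 0)\<close>.\<close>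
  define s where "s = sqrt ((f c)\<^sup>2 + (g c)\<^sup>2)"
  define C where "C = f c / s"
  define S where "S = g c / s"
  have s: "s\<^sup>2 = (f c)\<^sup>2 + (g c)\<^sup>2" and s0: "s \<noteq> 0"
    using False by (auto simp: s_def sum_power2_eq_zero_iff)
  have 1: "C\<^sup>2 + S\<^sup>2 = 1"
    using s s0 by (simp add: C_def S_def power_divide flip: add_divide_distrib s)
  have lin: "bilin m n (\<lambda>d. t * f d + u * g d) x y = t * bilin m n f x y + u * bilin m n g x y"
    for t u x y
    by (simp add: bilin_def algebra_simps sum.distrib sum_distrib_left)
  have rot: "(C * a + S * b)\<^sup>2 + (- S * a + C * b)\<^sup>2 = (C\<^sup>2 + S\<^sup>2) * (a\<^sup>2 + b\<^sup>2)" for a b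
    by algebra
  show ?thesis
    by (rule that[of "\<lambda>d. C * f d + S * g d" "\<lambda>d. - S * f d + C * g d"])
      (simp only: lin rot 1, simp, simp add: C_def S_def, simp)
qed

definition sq_list :: "nat \<Rightarrow> nat \<Rightarrow> (nat \<times> nat \<Rightarrow> real) list \<Rightarrow> (nat \<Rightarrow> real) \<Rightarrow> (nat \<Rightarrow> real) \<Rightarrow> real" where
  "sq_list m n bs x y = (\<Sum>b\<leftarrow>bs. (bilin m n b x y)\<^sup>2)"

text \<open>One column of a QR elimination: each member of the list is rotated against the current
  head, which collects the whole contribution at \<open>c\<close> while the other member loses
  it.\<close>

lemma clear_cell:
  assumes "\<forall>b\<in>set bs. \<forall>d. d \<notin> insert c A \<longrightarrow> b d = 0"
  shows "\<exists>h bs'. sq_list m n bs = sq_list m n (h # bs') \<and>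
    (\<forall>d. d \<notin> insert c A \<longrightarrow> h d = 0) \<and> (\<forall>b\<in>set bs'. \<forall>d. d \<notin> A \<longrightarrow> b d = 0)"
  using assms
proof (induction bs)
  case Nil
  show ?case
    by (intro exI[of _ "\<lambda>_. 0"] exI[of _ "[]"]) (simp add: sq_list_def bilin_def fun_eq_iff)
next
  case (Cons f bs)
  then obtain h bs' where IH: "sq_list m n bs = sq_list m n (h # bs')"
    "\<forall>d. d \<notin> insert c A \<longrightarrow> h d = 0" "\<forall>b\<in>set bs'. \<forall>d. d \<notin> A \<longrightarrow> b d = 0"
    by auto
  obtain f' g' where rot: "\<And>x y. (bilin m n f x y)\<^sup>2 + (bilin m n h x y)\<^sup>2
      = (bilin m n f' x y)\<^sup>2 + (bilin m n g' x y)\<^sup>2"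
    and g': "g' c = 0" and 0: "\<And>d. f d = 0 \<Longrightarrow> h d = 0 \<Longrightarrow> f' d = 0 \<and> g' d = 0"
    using givens[of m n f h c] by blast
  have "sq_list m n (f # bs) x y = sq_list m n (f' # g' # bs') x y" for x y
    using fun_cong[OF fun_cong[OF IH(1)], of x y] rot[of x y] by (simp add: sq_list_def)
  moreover have "\<forall>d. d \<notin> insert c A \<longrightarrow> f' d = 0" "\<forall>d. d \<notin> A \<longrightarrow> g' d = 0"
    using IH(2) Cons.prems 0 g' by (metis insertE list.set_intros(1))+
  ultimately show ?case
    using IH(3) by (intro exI[of _ f'] exI[of _ "g' # bs'"]) auto
qed

text \<open>Clearing the cells of the support one after another costs one square per cell; squares
  with empty support vanish.\<close>

lemma sq_list_short:
  assumes "finite A" "\<forall>b\<in>set bs. \<forall>d. d \<notin> A \<longrightarrow> b d = 0"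
  shows "\<exists>bs'. sq_list m n bs = sq_list m n bs' \<and> length bs' \<le> card A"
  using assms
proof (induction A arbitrary: bs rule: finite_induct)
  case empty
  have "bilin m n b x y = 0" if "b \<in> set bs" for b x y
    using empty that unfolding bilin_def by (intro sum.neutral) auto
  then have "sq_list m n bs = sq_list m n []"
    by (auto simp: sq_list_def fun_eq_iff intro!: sum_list_0 cong: map_cong)
  then show ?case by (intro exI[of _ "[]"]) simp
next
  case (insert c A)
  obtain h bs' where 1: "sq_list m n bs = sq_list m n (h # bs')"
    "\<forall>b\<in>set bs'. \<forall>d. d \<notin> A \<longrightarrow> b d = 0"
    using clear_cell[OF insert.prems, of m n] by auto
  obtain bs'' where 2: "sq_list m n bs' = sq_list m n bs''" "length bs'' \<le> card A"
    using insert.IH[OF 1(2)] by auto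
  have "sq_list m n bs x y = sq_list m n (h # bs'') x y" for x y
    using fun_cong[OF fun_cong[OF 2(1)], of x y] by (simp add: 1(1)) (simp add: sq_list_def)
  then show ?case
    using 2(2) insert.hyps by (intro exI[of _ "h # bs''"]) auto
qed

text \<open>Makes the set of ranks in \<open>BSR\<close> finite, so that its \<open>Max\<close> is a
  genuine maximum.\<close>

lemma SOS_rank_le:
  assumes "is_SOS m n P"
  shows "SOS_rank m n P \<le> m * n"
proof -
  obtain r where "sum_of_bilinear_squares m n r P"
    using assms unfolding is_SOS_def by (rule exE)
  then obtain b where P: "P = (\<lambda>x y. \<Sum>p=1..r. (bilin m n (b p) x y)\<^sup>2)"
    unfolding sum_of_bilinear_squares_iff by (rule exE)
  define A where "A = {1..m} \<times> {1..n}"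
  \<comment> \<open>\<open>bilin\<close> does not see coefficients off the grid; zeroing them gives
    the finite support that the elimination requires.\<close>
  define b' where "b' p c = (if c \<in> A then b p c else 0)" for p c
  have b': "bilin m n (b p) = bilin m n (b' p)" for p
    unfolding bilin_def by (intro ext sum.cong) (auto simp: b'_def A_def)
  have "P = sq_list m n (map b' [1..<Suc r])"
    by (simp add: P sq_list_def fun_eq_iff b' o_def sum_list_distinct_conv_sum_set
        atLeastLessThanSuc_atLeastAtMost del: upt_Suc)
  moreover have "\<forall>b\<in>set (map b' [1..<Suc r]). \<forall>d. d \<notin> A \<longrightarrow> b d = 0"
    unfolding set_map by (auto simp: b'_def simp del: upt_Suc)
  then obtain bs where "sq_list m n (map b' [1..<Suc r]) = sq_list m n bs" "length bs \<le> card A"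
    using sq_list_short[of A "map b' [1..<Suc r]" m n] by (auto simp: A_def simp del: upt_Suc)
  ultimately have P': "P = (\<lambda>x y. \<Sum>i<length bs. (bilin m n (bs ! i) x y)\<^sup>2)" "length bs \<le> m * n"
    by (auto simp: sq_list_def fun_eq_iff sum_list_sum_nth A_def atLeast0LessThan)
  have "sum_of_bilinear_squares m n (length bs) P"
    unfolding P' by (rule sum_of_bilinear_squares_reindex) auto
  then have "SOS_rank m n P \<le> length bs"
    unfolding SOS_rank_def by (rule Least_le)
  then show ?thesis using P'(2) by simp
qed

lemma BSR_ge:
  assumes "sum_of_bilinear_squares m n s P"
    and "\<And>r. sum_of_bilinear_squares m n r P \<Longrightarrow> N \<le> r"
  shows "N \<le> BSR m n"
proof -
  have "N \<le> SOS_rank m n P"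
    unfolding SOS_rank_def using assms LeastI[of "\<lambda>r. sum_of_bilinear_squares m n r P"] by auto
  also have "\<dots> \<le> BSR m n"
    unfolding BSR_def
  proof (rule Max_ge)
    show "finite {SOS_rank m n P |P. biquadratic_form m n P \<and> is_SOS m n P}"
      by (rule finite_subset[of _ "{..m * n}"]) (auto simp: SOS_rank_le)
    show "SOS_rank m n P \<in> {SOS_rank m n P |P. biquadratic_form m n P \<and> is_SOS m n P}"
      using assms(1) biquadratic_form_if_sum_of_bilinear_squares is_SOS_def by blast
  qed
  finally show ?thesis .
qed

section \<open>Gram vectors of weak admissible graphs\<close>

lemma nondegenerate_doubleton [simp]:
  "nondegenerate {(i, j), (k, l)} \<longleftrightarrow> i \<noteq> k \<and> j \<noteq> l"
  unfolding nondegenerate_def by (auto simp: doubleton_eq_iff)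

lemma opposite_cells_doubleton [simp]:
  "opposite_cells {(i, j), (k, l)} = {(i, l), (k, j)}"
  unfolding opposite_cells_def by (auto simp: doubleton_eq_iff)

lemma complementary_doubleton:
  "complementary {(i, j), (k, l)} e \<longleftrightarrow> i \<noteq> k \<and> j \<noteq> l \<and> e = {(i, l), (k, j)}"
  unfolding complementary_def by (auto simp: doubleton_eq_iff)

section \<open>Well-foundedness of the dependency relation\<close>

lemma pair_wf_digraph_dependency_graph: "pair_wf_digraph (dependency_graph E1 E2)"
  by unfold_locales (auto simp: dependency_graph_def)

text \<open>
  Complementary arcs are dropped because a complementary pair forces itself: its two inner
  products add up to 2 and neither exceeds 1.  The pairs are reversed, so that induction treats
  a 2-edge after the 2-edges it depends on.
\<close>

definition proper_dependency :: "('a \<times> 'b) set \<Rightarrow> ('a \<times> 'b) set set \<Rightarrow> ('a \<times> 'b) set rel" where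
  "proper_dependency E1 E2 =
    {(e', e). (e, e') \<in> parcs (dependency_graph E1 E2) \<and> \<not> complementary e e'}"

text \<open>\<open>H\<close> is the dependency graph with the complementary arcs deleted. A cycle of
  \<open>H\<close> is a cycle of the whole graph, so by (W2) its first arc joins complementary
  2-edges; but such arcs were deleted.\<close>

lemma wf_proper_dependency:
  assumes "finite E2" "cond_W2 E1 E2"
  shows "wf (proper_dependency E1 E2)"
proof (rule finite_acyclic_wf)
  have "proper_dependency E1 E2 \<subseteq> E2 \<times> E2"
    by (auto simp: proper_dependency_def dependency_graph_def)
  then show "finite (proper_dependency E1 E2)"
    using assms(1) finite_subset by blast
  define G where "G = dependency_graph E1 E2"
  define H where "H = \<lparr>pverts = pverts G, parcs = (proper_dependency E1 E2)\<inverse>\<rparr>"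
  interpret G: pair_wf_digraph G
    unfolding G_def by (rule pair_wf_digraph_dependency_graph)
  interpret H: pair_wf_digraph H
    by unfold_locales
      (auto simp: H_def proper_dependency_def G_def dependency_graph_def)
  have "pverts H \<subseteq> pverts G" "parcs H \<subseteq> parcs G"
    by (auto simp: H_def proper_dependency_def G_def)
  then have sub: "subgraph (with_proj H) (with_proj G)"
    using H.wf_digraph_axioms G.wf_digraph_axioms by (auto simp: subgraph_def compatible_def)
  show "acyclic (proper_dependency E1 E2)"
  proof (rule ccontr)
    assume "\<not> acyclic (proper_dependency E1 E2)"
    then obtain e where "(e, e) \<in> (proper_dependency E1 E2)\<^sup>+"
      unfolding acyclic_def by blast
    then have "(e, e) \<in> (parcs H)\<^sup>+"
      by (simp add: H_def trancl_converse)
    then have "\<exists>p. H.awalk e p e \<and> p \<noteq> []"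
      using H.reachable1_awalk[of e e] by simp
    then obtain p where "H.closed_w p"
      unfolding H.closed_w_def by blast
    then obtain q where q: "H.cycle q"
      using H.closed_w_imp_cycle by blast
    then have "G.cycle q"
      by (rule G.subgraph_cycle[OF sub])
    then have "complementary (fst (hd q)) (snd (hd q))"
      using assms(2) by (simp add: cond_W2_def G_def)
    moreover have "q \<noteq> []" "set q \<subseteq> parcs H"
      using q by (auto simp: H.cycle_def H.awalk_def)
    then have "hd q \<in> parcs H"
      using hd_in_set by blast
    ultimately show False
      by (auto simp: H_def proper_dependency_def)
  qed
qed

text \<open>Bessel's inequality for the standard basis vectors, summed over the basis.\<close>

lemma card_orthonormal_le:
  fixes v :: "'e \<Rightarrow> 'i \<Rightarrow> real"
  assumes "finite E" "finite I"
    and orth: "\<And>e f. e \<in> E \<Longrightarrow> f \<in> E \<Longrightarrow> (\<Sum>p\<in>I. v e p * v f p) = of_bool (e = f)"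
  shows "card E \<le> card I"
proof -
  have bessel: "(\<Sum>e\<in>E. v e q * v e q) \<le> 1" if q: "q \<in> I" for q
  proof -
    \<comment> \<open>\<open>a\<close> is the basis vector of coordinate \<open>q\<close> and
      \<open>w\<close> its orthogonal projection to the span of the family, so that
      \<open>w q\<close> is the squared norm of \<open>w\<close>.\<close>
    define a :: "'i \<Rightarrow> real" where "a p = (if p = q then 1 else 0)" for p
    define w where "w p = (\<Sum>e\<in>E. v e q * v e p)" for p
    have "(\<Sum>p\<in>I. a p * w p) = (\<Sum>p\<in>I. if p = q then w p else 0)"
      by (intro sum.cong) (auto simp: a_def)
    also have "\<dots> = w q" using q assms(2) by simp
    finally have aw: "(\<Sum>p\<in>I. a p * w p) = w q" .
    have "(\<Sum>p\<in>I. w p * w p)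
        = (\<Sum>p\<in>I. \<Sum>e\<in>E. \<Sum>f\<in>E. v e q * v f q * (v e p * v f p))"
      unfolding w_def sum_product by (intro sum.cong refl) (simp add: ac_simps)
    also have "\<dots> = (\<Sum>e\<in>E. \<Sum>f\<in>E. v e q * v f q * (\<Sum>p\<in>I. v e p * v f p))"
      unfolding sum_distrib_left
      by (rule trans[OF sum.swap], rule sum.cong[OF refl], rule sum.swap)
    also have "\<dots> = (\<Sum>e\<in>E. \<Sum>f\<in>E. if e = f then v e q * v f q else 0)"
      by (intro sum.cong refl) (simp add: orth)
    also have "\<dots> = w q" using assms(1) by (simp add: w_def)
    finally have ww: "(\<Sum>p\<in>I. w p * w p) = w q" .
    have "(\<Sum>p\<in>I. (a p - w p)\<^sup>2) = (\<Sum>p\<in>I. a p - 2 * (a p * w p) + w p * w p)"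
      by (intro sum.cong refl) (auto simp: a_def power2_eq_square algebra_simps)
    also have "\<dots> = (\<Sum>p\<in>I. a p) - 2 * w q + w q"
      by (simp only: sum.distrib sum_subtractf aw ww flip: sum_distrib_left)
    also have "(\<Sum>p\<in>I. a p) = 1" using q assms(2) by (simp add: a_def)
    finally have "(\<Sum>p\<in>I. (a p - w p)\<^sup>2) = 1 - w q" by simp
    moreover have "0 \<le> (\<Sum>p\<in>I. (a p - w p)\<^sup>2)" by (intro sum_nonneg) simp
    ultimately show ?thesis by (simp add: w_def)
  qed
  have "real (card E) = (\<Sum>e\<in>E. \<Sum>p\<in>I. v e p * v e p)"
    by (simp add: orth)
  also have "\<dots> = (\<Sum>p\<in>I. \<Sum>e\<in>E. v e p * v e p)"
    by (rule sum.swap)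
  also have "\<dots> \<le> (\<Sum>p\<in>I. 1)"
    by (intro sum_mono bessel)
  finally show ?thesis by simp
qed

section \<open>Gram matrix of the defining representation\<close>

locale admissible_graph =
  fixes S :: "'a set" and T :: "'b set" and E1 E2
  assumes adm: "weak_admissible S T E1 E2"
begin

text \<open>The inner products of the cell vectors in the representation with one square per
  edge.\<close>

definition \<gamma> :: "'a \<times> 'b \<Rightarrow> 'a \<times> 'b \<Rightarrow> real" where
  "\<gamma> c d = of_bool (\<exists>e\<in>edges E1 E2. c \<in> e \<and> d \<in> e)"

lemma \<gamma>_commute: "\<gamma> c d = \<gamma> d c"
  by (auto simp: \<gamma>_def)

lemma edges_disjoint:
  assumes "e \<in> edges E1 E2" "f \<in> edges E1 E2" "c \<in> e" "c \<in> f"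
  shows "e = f"
  using adm assms unfolding weak_admissible_def cond_S_def edges_def by blast

lemma edge_subset: "e \<in> edges E1 E2 \<Longrightarrow> e \<subseteq> S \<times> T"
  using adm unfolding weak_admissible_def augmented_bipartite_graph_def edges_def by blast

lemma finite_edges: "finite (edges E1 E2)"
proof (rule finite_subset)
  show "edges E1 E2 \<subseteq> Pow (S \<times> T)" using edge_subset by blast
  show "finite (Pow (S \<times> T))"
    using adm by (simp add: weak_admissible_def augmented_bipartite_graph_def)
qed

lemma occupied_iff: "c \<in> occupied E1 E2 \<longleftrightarrow> (\<exists>e\<in>edges E1 E2. c \<in> e)"
  by (auto simp: occupied_def edges_def)

lemma \<gamma>_same_edge: "e \<in> edges E1 E2 \<Longrightarrow> c \<in> e \<Longrightarrow> d \<in> e \<Longrightarrow> \<gamma> c d = 1"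
  by (auto simp: \<gamma>_def)

lemma \<gamma>_distinct_edges:
  assumes "e \<in> edges E1 E2" "f \<in> edges E1 E2" "e \<noteq> f" "c \<in> e" "d \<in> f"
  shows "\<gamma> c d = 0"
proof -
  have "g = e \<and> g = f" if "g \<in> edges E1 E2" "c \<in> g" "d \<in> g" for g
    using edges_disjoint[OF that(1) assms(1) that(2)] edges_disjoint[OF that(1) assms(2) that(3)]
      assms by simp
  then show ?thesis using assms(3) by (auto simp: \<gamma>_def)
qed

lemma card_edges: "card (edges E1 E2) = card E1 + card E2"
proof -
  have "finite (edges E1 E2)" by (rule finite_edges)
  then have "finite ((\<lambda>c. {c}) ` E1)" "finite E2" by (auto simp: edges_def)
  moreover have "((\<lambda>c. {c}) ` E1) \<inter> E2 = {}"
    using adm by (auto simp: weak_admissible_def augmented_bipartite_graph_def)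
  ultimately show ?thesis
    unfolding edges_def by (simp add: card_Un_disjoint card_image)
qed

text \<open>Edges are pairwise disjoint by (S), so at most one summand is nonzero. This is the form
  in which comparing coefficients produces \<gamma>.\<close>

lemma \<gamma>_altdef: "\<gamma> c d = (\<Sum>e\<in>edges E1 E2. of_bool (c \<in> e) * of_bool (d \<in> e))"
proof (cases "\<exists>e\<in>edges E1 E2. c \<in> e \<and> d \<in> e")
  case True
  then obtain e where e: "e \<in> edges E1 E2" "c \<in> e" "d \<in> e" by blast
  have "c \<in> e' \<and> d \<in> e' \<longleftrightarrow> e' = e" if "e' \<in> edges E1 E2" for e'
    using e edges_disjoint[OF that e(1), of c] by blast
  then have "(\<Sum>e'\<in>edges E1 E2. of_bool (c \<in> e') * of_bool (d \<in> e'))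
      = (\<Sum>e'\<in>edges E1 E2. if e' = e then 1 else (0 :: real))"
    by (intro sum.cong refl) (simp flip: of_bool_conj)
  also have "\<dots> = 1" using e finite_edges by simp
  finally show ?thesis using True by (simp add: \<gamma>_def)
next
  case False
  then have "(\<Sum>e\<in>edges E1 E2. of_bool (c \<in> e) * of_bool (d \<in> e)) = (0 :: real)"
    by (intro sum.neutral) auto
  then show ?thesis using False by (simp add: \<gamma>_def)
qed

end

section \<open>Gram vectors of an arbitrary representation\<close>

text \<open>
  \<open>V (i, j) p\<close> is the coefficient of \<open>x\<^sub>i y\<^sub>j\<close> in the \<open>p\<close>-th square of a
  representation of the form of the graph with \<open>r\<close> squares; \<open>gram\<close> is what the coefficients of
  the form say about the inner products of these vectors.
\<close>

locale gram_representation = admissible_graph S T E1 E2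
  for S :: "'a set" and T :: "'b set" and E1 E2 +
  fixes r :: nat and V :: "'a \<times> 'b \<Rightarrow> nat \<Rightarrow> real"
    and ip :: "'a \<times> 'b \<Rightarrow> 'a \<times> 'b \<Rightarrow> real"
  defines "ip c d \<equiv> \<Sum>p=1..r. V c p * V d p"
  assumes gram: "\<And>i j k l. \<lbrakk>i \<in> S; k \<in> S; j \<in> T; l \<in> T\<rbrakk> \<Longrightarrow>
      ip (i, j) (k, l) + ip (i, l) (k, j) = \<gamma> (i, j) (k, l) + \<gamma> (i, l) (k, j)"
begin

lemma ip_commute: "ip c d = ip d c"
  by (simp add: ip_def mult.commute)

text \<open>For two cells on a line the rectangle in \<open>gram\<close> collapses: both of its
  diagonals are the given pair, and the equation reads
  \<open>2 * ip c d = 2 * \<gamma> c d\<close>.\<close>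

lemma ip_line:
  assumes "c \<in> S \<times> T" "d \<in> S \<times> T" "fst c = fst d \<or> snd c = snd d"
  shows "ip c d = \<gamma> c d"
proof (cases c; cases d)
  fix i j k l assume cd: "c = (i, j)" "d = (k, l)"
  show ?thesis
    using gram[of i k j l] ip_commute[of c d] \<gamma>_commute[of c d] assms cd by auto
qed

text \<open>The squared norm of the vector of an unoccupied cell is \<open>\<gamma> c c = 0\<close>,
  so that vector is zero.\<close>

lemma ip_unoccupied:
  assumes "c \<in> S \<times> T" "d \<in> S \<times> T" "c \<notin> occupied E1 E2 \<or> d \<notin> occupied E1 E2"
  shows "ip c d = 0"
proof -
  have "V c p = 0" if "c \<in> S \<times> T" "c \<notin> occupied E1 E2" "p \<in> {1..r}" for c p
  proof -
    have "ip c c = 0"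
      using ip_line[of c c] that(1,2) by (auto simp: \<gamma>_def occupied_iff)
    then have "\<forall>p\<in>{1..r}. V c p * V c p = 0"
      unfolding ip_def by (subst (asm) sum_nonneg_eq_0_iff) auto
    then show ?thesis using that(3) by simp
  qed
  then show ?thesis
    using assms unfolding ip_def by (intro sum.neutral) auto
qed

lemma ip_opposite_unoccupied:
  assumes "i \<in> S" "k \<in> S" "j \<in> T" "l \<in> T"
    and "(i, l) \<notin> occupied E1 E2 \<or> (k, j) \<notin> occupied E1 E2"
  shows "ip (i, j) (k, l) = \<gamma> (i, j) (k, l)"
proof -
  have "\<gamma> (i, l) (k, j) = 0"
    using assms(5) by (auto simp: \<gamma>_def occupied_iff)
  moreover have "ip (i, l) (k, j) = 0"
    using assms by (intro ip_unoccupied) auto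
  ultimately show ?thesis using gram[of i k j l] assms by simp
qed

lemma sum_diff_squares: "(\<Sum>p=1..r. (V c p - V d p)\<^sup>2) = ip c c + ip d d - 2 * ip c d"
  by (simp only: ip_def power2_diff)
    (simp add: power2_eq_square sum.distrib sum_subtractf sum_distrib_left mult.assoc)

lemma ip_self: "e \<in> edges E1 E2 \<Longrightarrow> c \<in> e \<Longrightarrow> ip c c = 1"
  using ip_line[of c c] edge_subset \<gamma>_same_edge by auto

lemma ip_le_1:
  assumes "e \<in> edges E1 E2" "f \<in> edges E1 E2" "c \<in> e" "d \<in> f"
  shows "ip c d \<le> 1"
proof -
  have "0 \<le> (\<Sum>p=1..r. (V c p - V d p)\<^sup>2)"
    by (intro sum_nonneg) simp
  then show ?thesis
    unfolding sum_diff_squares using ip_self assms by auto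
qed

text \<open>Cells of an edge have unit vectors by \<open>ip_self\<close>, so inner product 1 means
  that all cells of \<open>e\<close> have the same vector.\<close>

definition resolved :: "('a \<times> 'b) set \<Rightarrow> bool" where
  "resolved e \<longleftrightarrow> (\<forall>c\<in>e. \<forall>d\<in>e. ip c d = 1)"

lemma ip_resolved:
  assumes "resolved e" "c \<in> e" "d \<in> e"
  shows "ip c x = ip d x"
proof -
  have "(\<Sum>p=1..r. (V c p - V d p)\<^sup>2) = 0"
    unfolding sum_diff_squares using assms by (simp add: resolved_def)
  then have "\<forall>p\<in>{1..r}. (V c p - V d p)\<^sup>2 = 0"
    by (subst (asm) sum_nonneg_eq_0_iff) auto
  then show ?thesis
    unfolding ip_def by (intro sum.cong) auto
qed

text \<open>In resolved edges the choice of cells does not affect the inner product, so one pair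
  with inner product 0 suffices. If the edges share a row or column, take two cells on that line;
  otherwise (W3) provides an unoccupied opposite cell, hence a pair whose other diagonal contributes
  nothing.\<close>

lemma orthogonal_if_resolved:
  assumes e: "e \<in> E2" "resolved e" and f: "f \<in> edges E1 E2" "resolved f"
    and "e \<noteq> f" "c \<in> e" "d \<in> f"
  shows "ip c d = 0"
proof -
  have e': "e \<in> edges E1 E2" using e by (simp add: edges_def)
  have sub: "e \<subseteq> S \<times> T" "f \<subseteq> S \<times> T" using e' f edge_subset by auto
  have \<gamma>0: "\<gamma> a b = 0" if "a \<in> e" "b \<in> f" for a b
    using \<gamma>_distinct_edges e' f \<open>e \<noteq> f\<close> that by blast
  have "\<exists>a\<in>e. \<exists>b\<in>f. ip a b = 0"
  proof (cases "vertex_disjoint e f")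
    case True
    have "cond_W3 E1 E2" using adm by (simp add: weak_admissible_def)
    then obtain x where "x \<in> pair_opposite_cells e f" and x: "x \<notin> occupied E1 E2"
      using True e f unfolding cond_W3_def by blast
    then obtain a b where ab: "a \<in> e" "b \<in> f" and "x = (fst a, snd b) \<or> x = (fst b, snd a)"
      unfolding pair_opposite_cells_def by auto
    then have "ip (fst a, snd a) (fst b, snd b) = \<gamma> (fst a, snd a) (fst b, snd b)"
      using x sub by (intro ip_opposite_unoccupied) (auto simp: mem_Times_iff)
    then show ?thesis using \<gamma>0 ab by auto
  next
    case False
    then obtain a b where ab: "a \<in> e" "b \<in> f" "fst a = fst b \<or> snd a = snd b"
      unfolding vertex_disjoint_def by auto
    then have "ip a b = \<gamma> a b"
      using sub by (intro ip_line) auto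
    then show ?thesis using \<gamma>0 ab by auto
  qed
  then obtain a b where ab: "a \<in> e" "b \<in> f" "ip a b = 0" by blast
  have "ip c d = ip a d" using ip_resolved[OF e(2)] \<open>c \<in> e\<close> ab by blast
  also have "\<dots> = ip a b" using ip_resolved[OF f(2)] \<open>d \<in> f\<close> ab ip_commute by metis
  finally show ?thesis using ab by simp
qed

lemma resolved_singleton: "c \<in> E1 \<Longrightarrow> resolved {c}"
  using ip_self[of "{c}" c] by (simp add: resolved_def edges_def)

text \<open>Since \<gamma> of the two halves is 1, \<open>gram\<close> reduces the claim to showing
  that \<open>ip\<close> and \<gamma> agree on the two opposite cells. The induction makes this
  available whenever these lie in two different edges.\<close>

lemma resolved_2_edge:
  assumes "e \<in> E2"
  shows "resolved e"
proof -
  have "card f = 2" "f \<subseteq> S \<times> T" if "f \<in> E2" for f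
    using adm that by (auto simp: weak_admissible_def augmented_bipartite_graph_def)
  then have form: "\<exists>i j k l. f = {(i, j), (k, l)} \<and> (i, j) \<noteq> (k, l)
      \<and> i \<in> S \<and> k \<in> S \<and> j \<in> T \<and> l \<in> T" if "f \<in> E2" for f
    using that by (fastforce simp: card_2_iff)
  have resolvedI: "resolved f" if "f \<in> E2" "f = {c, d}" "ip c d = 1" for f c d
    using that ip_commute[of c d] ip_self[of f] by (auto simp: resolved_def edges_def)
  have degenerate: "resolved f" if f: "f \<in> E2" "\<not> nondegenerate f" for f
  proof -
    obtain i j k l where *: "f = {(i, j), (k, l)}" "i \<in> S" "k \<in> S" "j \<in> T" "l \<in> T"
      using form f by blast
    then have "ip (i, j) (k, l) = \<gamma> (i, j) (k, l)"
      using f by (intro ip_line) auto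
    also have "\<dots> = 1" using f * by (intro \<gamma>_same_edge[of f]) (auto simp: edges_def)
    finally show ?thesis using resolvedI f * by blast
  qed
  have "finite E2"
    using finite_edges by (simp add: edges_def)
  then have "wf (proper_dependency E1 E2)"
    using adm by (intro wf_proper_dependency) (auto simp: weak_admissible_def)
  then show ?thesis using assms
  proof (induction e rule: wf_induct_rule)
    case (less e)
    show ?case
    proof (cases "nondegenerate e")
      case False
      then show ?thesis using degenerate less.prems by blast
    next
      case True
      obtain i j k l where e: "e = {(i, j), (k, l)}" and mem: "i \<in> S" "k \<in> S" "j \<in> T" "l \<in> T"
        using form less.prems by blast
      have ne: "i \<noteq> k" "j \<noteq> l" using True e by auto
      have \<gamma>1: "\<gamma> (i, j) (k, l) = 1"
        using less.prems e by (intro \<gamma>_same_edge[of e]) (auto simp: edges_def)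
      show ?thesis
      proof (cases "(i, l) \<in> occupied E1 E2 \<and> (k, j) \<in> occupied E1 E2")
        case False
        then have "ip (i, j) (k, l) = 1"
          using ip_opposite_unoccupied[OF mem] \<gamma>1 by auto
        then show ?thesis using resolvedI less.prems e by blast
      next
        case True
        then obtain f g where f: "f \<in> edges E1 E2" "(i, l) \<in> f"
          and g: "g \<in> edges E1 E2" "(k, j) \<in> g"
          unfolding occupied_iff by blast
        show ?thesis
        proof (cases "f = g")
          case True
          \<comment> \<open>Both opposite cells lie in the same edge, which is the complementary
            2-edge. The two inner products sum to 2 and are at most 1 each, so both equal 1.\<close>
          have "\<gamma> (i, l) (k, j) = 1" using f g True by (intro \<gamma>_same_edge[of f]) auto
          then have "ip (i, j) (k, l) + ip (i, l) (k, j) = 2"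
            using gram[of i k j l] mem \<gamma>1 by simp
          moreover have "ip (i, j) (k, l) \<le> 1" "ip (i, l) (k, j) \<le> 1"
            using ip_le_1[of e e] ip_le_1[of f g] less.prems e f g by (auto simp: edges_def)
          ultimately show ?thesis using resolvedI[OF less.prems e] by linarith
        next
          case False
          \<comment> \<open>An edge through an opposite cell is a 1-edge, a degenerate 2-edge, or a
            predecessor of \<open>e\<close> in the induction. It is not complementary to
            \<open>e\<close>, because no single edge contains both opposite cells here.\<close>
          have res: "resolved h" if h: "h \<in> edges E1 E2" "h = f \<or> h = g" for h
          proof (cases "h \<in> E2 \<and> nondegenerate h")
            case True
            have "(i, l) \<notin> g" "(k, j) \<notin> f"
              using edges_disjoint f g False by blast+
            then have "\<not> complementary e h"
              using h by (auto simp: e complementary_doubleton)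
            moreover have "e \<noteq> h" using h f g ne e by auto
            ultimately have "(h, e) \<in> proper_dependency E1 E2"
              using True \<open>nondegenerate e\<close> less.prems h f g
                \<open>(i, l) \<in> occupied E1 E2 \<and> (k, j) \<in> occupied E1 E2\<close>
              by (auto simp: proper_dependency_def dependency_graph_def e)
            then show ?thesis using less.IH True by blast
          next
            case False
            then show ?thesis
              using h degenerate resolved_singleton by (auto simp: edges_def)
          qed
          \<comment> \<open>\<open>orthogonal_if_resolved\<close> asks for a 2-edge among
            \<open>f\<close> and \<open>g\<close>; (W2') supplies one.\<close>
          have "cond_W2' E1 E2" using adm by (simp add: weak_admissible_def)
          then have "\<not> ((i, l) \<in> E1 \<and> (k, j) \<in> E1)"
            using less.prems True ne unfolding cond_W2'_def e by auto
          then have "f \<in> E2 \<or> g \<in> E2" using f g by (auto simp: edges_def)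
          then have "ip (i, l) (k, j) = 0"
          proof
            assume "f \<in> E2"
            then show ?thesis using orthogonal_if_resolved[of f g] res f g False by blast
          next
            assume "g \<in> E2"
            then have "ip (k, j) (i, l) = 0"
              using orthogonal_if_resolved[of g f] res f g False by blast
            then show ?thesis by (simp add: ip_commute)
          qed
          moreover have "\<gamma> (i, l) (k, j) = 0" using \<gamma>_distinct_edges f g False by blast
          ultimately have "ip (i, j) (k, l) = 1" using gram[of i k j l] mem \<gamma>1 by simp
          then show ?thesis using resolvedI less.prems e by blast
        qed
      qed
    qed
  qed
qed

lemma resolved_edge: "e \<in> edges E1 E2 \<Longrightarrow> resolved e"
  using resolved_singleton resolved_2_edge by (auto simp: edges_def)

lemma orthogonal_if_E2:
  assumes "e \<in> edges E1 E2" "f \<in> edges E1 E2" "e \<noteq> f" "c \<in> e" "d \<in> f" "e \<in> E2 \<or> f \<in> E2"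
  shows "ip c d = 0"
  using assms orthogonal_if_resolved resolved_edge ip_commute by metis

text \<open>What remains are two 1-edges in general position with both opposite cells occupied.
  Those cells are not the halves of one 2-edge by (W2'), nor both 1-edges by \<open>C4_free\<close>,
  so the pair involves a 2-edge and is already known to be orthogonal.\<close>

lemma orthogonal:
  assumes ef: "e \<in> edges E1 E2" "f \<in> edges E1 E2" "e \<noteq> f" "c \<in> e" "d \<in> f"
  shows "ip c d = 0"
proof (cases "e \<in> E2 \<or> f \<in> E2")
  case True
  then show ?thesis using orthogonal_if_E2 ef by blast
next
  case False
  obtain i j k l where c: "c = (i, j)" and d: "d = (k, l)" by (cases c; cases d)
  have E1: "(i, j) \<in> E1" "(k, l) \<in> E1" using False ef c d by (auto simp: edges_def)
  have mem: "i \<in> S" "k \<in> S" "j \<in> T" "l \<in> T" using edge_subset ef c d by blast+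
  have \<gamma>0: "\<gamma> (i, j) (k, l) = 0" using \<gamma>_distinct_edges ef c d by blast
  show ?thesis
  proof (cases "i = k \<or> j = l")
    case True
    then show ?thesis using ip_line[of c d] mem \<gamma>0 c d by auto
  next
    case ne: False
    show ?thesis
    proof (cases "(i, l) \<in> occupied E1 E2 \<and> (k, j) \<in> occupied E1 E2")
      case False
      then show ?thesis using ip_opposite_unoccupied[OF mem] \<gamma>0 c d by auto
    next
      case True
      then obtain g h where g: "g \<in> edges E1 E2" "(i, l) \<in> g"
        and h: "h \<in> edges E1 E2" "(k, j) \<in> h"
        unfolding occupied_iff by blast
      have "g \<noteq> h"
      proof
        assume "g = h"
        then have "g \<in> E2" using g h ne by (auto simp: edges_def)
        moreover then have "card g = 2"
          using adm by (auto simp: weak_admissible_def augmented_bipartite_graph_def)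
        then have "g = {(i, l), (k, j)}"
          using g h \<open>g = h\<close> ne by (auto simp: card_2_iff)
        ultimately have "nondegenerate g" "opposite_cells g \<subseteq> E1" "g \<in> E2"
          using ne E1 by auto
        then show False
          using adm unfolding weak_admissible_def cond_W2'_def by blast
      qed
      moreover have "\<not> ((i, l) \<in> E1 \<and> (k, j) \<in> E1)"
        using adm E1 ne unfolding weak_admissible_def C4_free_def by blast
      then have "g \<in> E2 \<or> h \<in> E2" using g h by (auto simp: edges_def)
      ultimately have "ip (i, l) (k, j) = 0" "\<gamma> (i, l) (k, j) = 0"
        using orthogonal_if_E2 \<gamma>_distinct_edges g h by blast+
      then show ?thesis using gram[of i k j l] mem \<gamma>0 c d by simp
    qed
  qed
qed

lemma card_edges_le: "card E1 + card E2 \<le> r"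
proof -
  have "e \<noteq> {}" if "e \<in> edges E1 E2" for e
    using that adm by (auto simp: edges_def weak_admissible_def augmented_bipartite_graph_def)
  then have "\<forall>e\<in>edges E1 E2. \<exists>c. c \<in> e" by blast
  then obtain h where h: "\<And>e. e \<in> edges E1 E2 \<Longrightarrow> h e \<in> e" by metis
  have "(\<Sum>p=1..r. V (h e) p * V (h f) p) = of_bool (e = f)"
    if "e \<in> edges E1 E2" "f \<in> edges E1 E2" for e f
    using that h orthogonal[of e f "h e" "h f"] ip_self[of e "h e"] unfolding ip_def by auto
  then have "card (edges E1 E2) \<le> card {1..r}"
    using finite_edges by (intro card_orthonormal_le[of _ _ "\<lambda>e. V (h e)"]) auto
  then show ?thesis by (simp add: card_edges)
qed

end

lemma BSR_ge_card_edges: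
  assumes "weak_admissible {1..m} {1..n} E1 E2"
  shows "card E1 + card E2 \<le> BSR m n"
proof (rule BSR_ge)
  interpret admissible_graph "{1..m}" "{1..n}" E1 E2
    using assms by unfold_locales
  define \<beta> :: "(nat \<times> nat) set \<Rightarrow> nat \<times> nat \<Rightarrow> real" where "\<beta> e c = of_bool (c \<in> e)" for e c
  let ?P = "\<lambda>x y. \<Sum>e\<in>edges E1 E2. (bilin m n (\<beta> e) x y)\<^sup>2"
  show "sum_of_bilinear_squares m n (card (edges E1 E2)) ?P"
    using finite_edges by (rule sum_of_bilinear_squares_reindex) simp
  fix r assume "sum_of_bilinear_squares m n r ?P"
  then obtain b where "?P = (\<lambda>x y. \<Sum>p=1..r. (bilin m n (b p) x y)\<^sup>2)"
    unfolding sum_of_bilinear_squares_iff by (rule exE)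
  \<comment> \<open>The vector of a cell lists its coefficients in the \<open>r\<close> squares;
    comparing with the edge indicators \<beta> gives \<open>gram\<close>.\<close>
  then have "gram_representation {1..m} {1..n} E1 E2 r (\<lambda>c p. b p c)"
    using gram_eq_if_sum_of_squares_eq[of m n b "{1..r}" \<beta> "edges E1 E2"]
    by unfold_locales (simp add: \<gamma>_altdef \<beta>_def)
  then show "card E1 + card E2 \<le> r"
    by (rule gram_representation.card_edges_le)
qed

section \<open>Relabelling\<close>

text \<open>A cycle visits only vertices in \<open>pverts H\<close>, where \<open>g\<close> is
  injective, so its vertices stay distinct. Serves to pull cycles back along the inverse of a
  relabelling.\<close>

lemma cycle_map:
  assumes "pre_digraph.cycle (with_proj H) p"
    and "inj_on g (pverts H)" "g ` pverts H \<subseteq> pverts G" "map_prod g g ` parcs H \<subseteq> parcs G"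
    and H: "parcs H \<subseteq> pverts H \<times> pverts H"
  shows "pre_digraph.cycle (with_proj G) (map (map_prod g g) p)"
proof -
  have verts: "pawalk_verts (g u) (map (map_prod g g) p) = map g (pawalk_verts u p)" for u p
    by (induction p arbitrary: u) auto
  have cas: "pcas u p v \<Longrightarrow> pcas (g u) (map (map_prod g g) p) (g v)" for u p v
    by (induction p arbitrary: u) auto
  have sub: "set (pawalk_verts u p) \<subseteq> pverts H" if "u \<in> pverts H" "set p \<subseteq> parcs H" for u p
    using that
  proof (induction p arbitrary: u)
    case (Cons a p)
    then have "fst a \<in> pverts H" "snd a \<in> pverts H" using H by auto
    then show ?case using Cons by auto
  qed simp
  obtain u where u: "u \<in> pverts H" "set p \<subseteq> parcs H" "pcas u p u"
    "distinct (tl (pawalk_verts u p))" "p \<noteq> []"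
    using assms(1)
    by (auto simp: pre_digraph.cycle_def pre_digraph.awalk_def cas_with_proj_eq
        awalk_verts_with_proj_eq)
  have "set (tl (pawalk_verts u p)) \<subseteq> pverts H"
    using sub[OF u(1,2)] list.set_sel(2)[of "pawalk_verts u p"]
    by (cases "pawalk_verts u p") auto
  then have "distinct (tl (pawalk_verts (g u) (map (map_prod g g) p)))"
    unfolding verts using u(4) assms(2) by (auto simp: distinct_map inj_on_subset simp flip: map_tl)
  then show ?thesis
    using u assms(3,4) cas[OF u(3)]
    by (auto simp: pre_digraph.cycle_def pre_digraph.awalk_def cas_with_proj_eq
        awalk_verts_with_proj_eq intro!: exI[of _ "g u"])
qed

text \<open>Used twice: from ordered pairs to two-element sets as rows, and from there to the index
  sets \<open>{1..15}\<close> and \<open>{1..6}\<close>.\<close>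

locale relabelling =
  fixes S :: "'a set" and T :: "'b set" and E1 E2
    and \<phi> :: "'a \<Rightarrow> 'c" and \<psi> :: "'b \<Rightarrow> 'd" and F
  defines "F \<equiv> map_prod \<phi> \<psi>"
  assumes graph: "augmented_bipartite_graph S T E1 E2"
    and inj_\<phi>: "inj_on \<phi> S" and inj_\<psi>: "inj_on \<psi> T"
begin

lemma inj_F: "inj_on F (S \<times> T)"
  unfolding F_def using inj_\<phi> inj_\<psi> by (rule map_prod_inj_on)

lemma E1_subset: "E1 \<subseteq> S \<times> T" and E2_subset: "e \<in> E2 \<Longrightarrow> e \<subseteq> S \<times> T"
  and card_E2: "e \<in> E2 \<Longrightarrow> card e = 2"
  using graph by (auto simp: augmented_bipartite_graph_def)

lemma F_mem: "A \<subseteq> S \<times> T \<Longrightarrow> c \<in> S \<times> T \<Longrightarrow> F c \<in> F ` A \<longleftrightarrow> c \<in> A"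
  using inj_on_image_mem_iff[OF inj_F] by blast

lemma F_pair: "F (i, j) = (\<phi> i, \<psi> j)"
  by (simp add: F_def)

lemma occupied_subset: "occupied E1 E2 \<subseteq> S \<times> T"
  using E1_subset E2_subset by (auto simp: occupied_def)

lemma occupied_image: "occupied (F ` E1) ((`) F ` E2) = F ` occupied E1 E2"
  by (auto simp: occupied_def)

lemma E2_form:
  assumes "e \<in> E2"
  obtains i j k l where "e = {(i, j), (k, l)}" "(i, j) \<noteq> (k, l)" "i \<in> S" "j \<in> T" "k \<in> S" "l \<in> T"
proof -
  obtain c d where "e = {c, d}" "c \<noteq> d"
    using card_E2[OF assms] by (auto simp: card_2_iff)
  then show ?thesis
    using that E2_subset[OF assms] by (cases c; cases d) auto
qed

lemma nondegenerate_image: "e \<in> E2 \<Longrightarrow> nondegenerate (F ` e) \<longleftrightarrow> nondegenerate e"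
  by (erule E2_form) (auto simp: F_pair dest: inj_onD[OF inj_\<phi>] inj_onD[OF inj_\<psi>])

lemma opposite_cells_image: "e \<in> E2 \<Longrightarrow> opposite_cells (F ` e) = F ` opposite_cells e"
  by (erule E2_form) (auto simp: F_pair)

lemma opposite_cells_subset: "e \<in> E2 \<Longrightarrow> opposite_cells e \<subseteq> S \<times> T"
  by (erule E2_form) auto

lemma image_subset_iff_F: "A \<subseteq> S \<times> T \<Longrightarrow> B \<subseteq> S \<times> T \<Longrightarrow> F ` A \<subseteq> F ` B \<longleftrightarrow> A \<subseteq> B"
  using F_mem by blast

lemma complementary_imageI: "complementary e f \<Longrightarrow> e \<in> E2 \<Longrightarrow> complementary (F ` e) (F ` f)"
  by (erule E2_form)
    (auto simp: F_pair complementary_doubleton dest: inj_onD[OF inj_\<phi>] inj_onD[OF inj_\<psi>])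

lemma inj_on_E2: "inj_on ((`) F) E2"
  using inj_F E2_subset by (intro inj_onI) (metis inj_on_image_eq_iff)

lemma graph_image:
  "augmented_bipartite_graph (\<phi> ` S) (\<psi> ` T) (F ` E1) ((`) F ` E2)"
  unfolding augmented_bipartite_graph_def
proof (intro conjI ballI)
  show "finite (\<phi> ` S)" "finite (\<psi> ` T)"
    using graph by (auto simp: augmented_bipartite_graph_def)
  have F: "F ` A \<subseteq> \<phi> ` S \<times> \<psi> ` T" if "A \<subseteq> S \<times> T" for A
    using that by (auto simp: F_def)
  show "F ` E1 \<subseteq> \<phi> ` S \<times> \<psi> ` T"
    using E1_subset by (rule F)
  fix e' assume "e' \<in> (`) F ` E2"
  then obtain e where e: "e \<in> E2" "e' = F ` e" by blast
  then show "e' \<subseteq> \<phi> ` S \<times> \<psi> ` T" using F E2_subset by simp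
  show "card e' = 2"
    using e card_E2 card_image[OF inj_on_subset[OF inj_F E2_subset]] by simp
qed

lemma cond_S_image:
  assumes "cond_S E1 E2"
  shows "cond_S (F ` E1) ((`) F ` E2)"
proof -
  have disj: "F ` A \<inter> F ` B = {}" if "A \<inter> B = {}" "A \<subseteq> S \<times> T" "B \<subseteq> S \<times> T" for A B
    using that inj_on_image_Int[OF inj_F that(2,3)] by simp
  have "F ` e \<inter> F ` f = {}" if "e \<in> E2" "f \<in> E2" "F ` f \<noteq> F ` e" for e f
  proof (rule disj)
    have "f \<noteq> e" using that by blast
    then show "e \<inter> f = {}" using assms that by (auto simp: cond_S_def)
  qed (use that E2_subset in auto)
  moreover have "F ` e \<inter> F ` E1 = {}" if "e \<in> E2" for e
    using assms that E2_subset E1_subset by (intro disj) (auto simp: cond_S_def)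
  ultimately show ?thesis
    unfolding cond_S_def by simp
qed

lemma C4_free_image: "C4_free E1 \<Longrightarrow> C4_free (F ` E1)"
  unfolding C4_free_def
proof (elim contrapos_nn exE conjE)
  fix i' k' j' l'
  assume ne: "i' \<noteq> k'" "j' \<noteq> l'" and sub: "{(i', j'), (i', l'), (k', j'), (k', l')} \<subseteq> F ` E1"
  have "F ` E1 \<subseteq> \<phi> ` S \<times> \<psi> ` T"
    using E1_subset by (auto simp: F_def)
  then have "i' \<in> \<phi> ` S" "k' \<in> \<phi> ` S" "j' \<in> \<psi> ` T" "l' \<in> \<psi> ` T"
    using sub by auto
  then obtain i j k l where *: "i' = \<phi> i" "k' = \<phi> k" "j' = \<psi> j" "l' = \<psi> l"
    and mem: "i \<in> S" "k \<in> S" "j \<in> T" "l \<in> T"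
    by (elim imageE)
  have "(a, b) \<in> E1" if "(\<phi> a, \<psi> b) \<in> F ` E1" "a \<in> S" "b \<in> T" for a b
    using F_mem[OF E1_subset, of "(a, b)"] that by (simp add: F_pair)
  then have "{(i, j), (i, l), (k, j), (k, l)} \<subseteq> E1"
    using sub mem unfolding * by simp
  then show "\<exists>i k j l. i \<noteq> k \<and> j \<noteq> l \<and> {(i, j), (i, l), (k, j), (k, l)} \<subseteq> E1"
    using ne unfolding * by (intro exI[of _ i] exI[of _ k] exI[of _ j] exI[of _ l] conjI) auto
qed

lemma cond_W2'_image: "cond_W2' E1 E2 \<Longrightarrow> cond_W2' (F ` E1) ((`) F ` E2)"
  unfolding cond_W2'_def
  by (auto simp: nondegenerate_image opposite_cells_image image_subset_iff_F E1_subset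
      opposite_cells_subset)

lemma cond_W3_image:
  assumes "cond_W3 E1 E2"
  shows "cond_W3 (F ` E1) ((`) F ` E2)"
  unfolding cond_W3_def
proof (intro ballI impI)
  fix e' f'
  assume "e' \<in> (`) F ` E2" "f' \<in> edges (F ` E1) ((`) F ` E2)" and vd: "vertex_disjoint e' f'"
  moreover have "edges (F ` E1) ((`) F ` E2) = (`) F ` edges E1 E2"
    by (simp add: edges_def image_Un image_image)
  ultimately obtain e f where e: "e \<in> E2" "e' = F ` e" and f: "f \<in> edges E1 E2" "f' = F ` f"
    by (auto elim!: imageE)
  have "vertex_disjoint e f"
    using vd unfolding e f vertex_disjoint_def F_def by (auto simp: image_image) force+
  then obtain c where c: "c \<in> pair_opposite_cells e f" "c \<notin> occupied E1 E2"
    using assms e f unfolding cond_W3_def by blast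
  have "e \<subseteq> S \<times> T" "f \<subseteq> S \<times> T"
    using e f E1_subset E2_subset by (auto simp: edges_def)
  then have "c \<in> S \<times> T" using c by (auto simp: pair_opposite_cells_def)
  then have "F c \<notin> occupied (F ` E1) ((`) F ` E2)"
    using c F_mem[OF occupied_subset] by (simp add: occupied_image)
  moreover have "F c \<in> pair_opposite_cells e' f'"
  proof -
    have "fst ` F ` A = \<phi> ` fst ` A" "snd ` F ` A = \<psi> ` snd ` A" for A
      by (simp_all add: F_def image_image)
    then show ?thesis
      using c(1) unfolding e f pair_opposite_cells_def by (cases c) (auto simp: F_pair)
  qed
  ultimately show "\<exists>c\<in>pair_opposite_cells e' f'. c \<notin> occupied (F ` E1) ((`) F ` E2)" by blast
qed

lemma cond_W2_image:
  assumes "cond_W2 E1 E2"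
  shows "cond_W2 (F ` E1) ((`) F ` E2)"
  unfolding cond_W2_def
proof (intro allI impI)
  define G where "G = dependency_graph E1 E2"
  define H where "H = dependency_graph (F ` E1) ((`) F ` E2)"
  \<comment> \<open>Cycles are transported backwards by \<open>g\<close> to apply (W2) of the
    original graph; the complementarity found there is carried forwards again.\<close>
  define g where "g = inv_into E2 ((`) F)"
  have g: "g (F ` e) = e" if "e \<in> E2" for e
    using that inj_on_E2 by (simp add: g_def)
  have "inj_on g (pverts H)"
    by (auto simp: H_def dependency_graph_def g intro!: inj_onI)
  moreover have "g ` pverts H \<subseteq> pverts G"
    by (auto simp: H_def G_def dependency_graph_def g nondegenerate_image)
  moreover have "parcs H \<subseteq> pverts H \<times> pverts H"
    by (auto simp: H_def dependency_graph_def)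
  moreover have "map_prod g g ` parcs H \<subseteq> parcs G"
  proof (rule image_subsetI)
    fix a assume "a \<in> parcs H"
    then obtain e' f' where a: "a = (e', f')" "(e', f') \<in> parcs H" by (cases a) auto
    from a(2) obtain e f where ef: "e \<in> E2" "f \<in> E2" and e': "e' = F ` e" and f': "f' = F ` f"
      and *: "nondegenerate (F ` e)" "nondegenerate (F ` f)" "F ` e \<noteq> F ` f"
        "opposite_cells (F ` e) \<subseteq> occupied (F ` E1) ((`) F ` E2)"
        "F ` f \<inter> opposite_cells (F ` e) \<noteq> {}"
      unfolding H_def dependency_graph_def by simp blast
    have "F ` (f \<inter> opposite_cells e) \<noteq> {}"
      using * ef inj_on_image_Int[OF inj_F E2_subset[OF ef(2)] opposite_cells_subset[OF ef(1)]]
      by (simp add: opposite_cells_image)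
    then have "(e, f) \<in> parcs G"
      using * ef by (auto simp: G_def dependency_graph_def nondegenerate_image occupied_image
          opposite_cells_image image_subset_iff_F opposite_cells_subset occupied_subset)
    then show "map_prod g g a \<in> parcs G"
      using ef by (simp add: a e' f' g)
  qed
  ultimately have map: "pre_digraph.cycle (with_proj G) (map (map_prod g g) p)"
    if "pre_digraph.cycle (with_proj H) p" for p
    using that by (intro cycle_map[of H])
  fix p assume p: "pre_digraph.cycle (with_proj (dependency_graph (F ` E1) ((`) F ` E2))) p"
  then have "p \<noteq> []" "set p \<subseteq> parcs H"
    by (auto simp: H_def pre_digraph.cycle_def pre_digraph.awalk_def)
  then have hd: "hd p \<in> parcs H" using hd_in_set by blast
  have "length (map (map_prod g g) p) = 2"
    "complementary (fst (hd (map (map_prod g g) p))) (snd (hd (map (map_prod g g) p)))"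
    using assms map p unfolding cond_W2_def G_def H_def by blast+
  then have len: "length p = 2" and c: "complementary (g (fst (hd p))) (g (snd (hd p)))"
    using \<open>p \<noteq> []\<close> by (auto simp: hd_map)
  have "fst (hd p) \<in> (`) F ` E2" "snd (hd p) \<in> (`) F ` E2"
    using hd by (cases "hd p", simp add: H_def dependency_graph_def)+
  then obtain e f where "e \<in> E2" "f \<in> E2" "fst (hd p) = F ` e" "snd (hd p) = F ` f"
    by (elim imageE)
  then have "complementary (fst (hd p)) (snd (hd p))"
    using c complementary_imageI by (simp add: g)
  with len show "length p = 2 \<and> complementary (fst (hd p)) (snd (hd p))" ..
qed

lemma weak_admissible_image:
  "weak_admissible S T E1 E2 \<Longrightarrow> weak_admissible (\<phi> ` S) (\<psi> ` T) (F ` E1) ((`) F ` E2)"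
  unfolding weak_admissible_def
  by (simp add: graph_image cond_S_image C4_free_image cond_W2_image cond_W2'_image cond_W3_image)

lemma card_E1_image: "card (F ` E1) = card E1"
  using card_image[OF inj_on_subset[OF inj_F E1_subset]] .

lemma card_E2_image: "card ((`) F ` E2) = card E2"
  using card_image[OF inj_on_E2] .

end

section \<open>Extremal numbers\<close>

lemma C4_free_card_le:
  assumes "finite A" "finite B" "E \<subseteq> A \<times> B" "C4_free E"
  shows "card E \<le> card A + (card B choose 2)"
proof -
  define N where "N i = {j\<in>B. (i, j) \<in> E}" for i
  define Q where "Q i = {p. p \<subseteq> N i \<and> card p = 2}" for i
  have fin: "finite (N i)" for i using assms(2) by (simp add: N_def)
  have finQ: "finite (Q i)" for i using fin[of i] by (simp add: Q_def)
  \<comment> \<open>Equality holds at \<open>k = 1\<close> and \<open>k = 2\<close>; all rows of the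
    incidence graph of \<open>K6\<close> have degree 2, so nothing is lost there.\<close>
  have le: "k \<le> 1 + (k choose 2)" for k :: nat
    by (cases k) (simp_all add: numeral_2_eq_2)
  have "E = Sigma A N" using assms(3) by (auto simp: N_def)
  then have "card E = (\<Sum>i\<in>A. card (N i))"
    using assms(1) fin by (simp add: card_SigmaI)
  also have "\<dots> \<le> (\<Sum>i\<in>A. 1 + card (Q i))"
    using le by (intro sum_mono) (simp add: Q_def n_subsets fin)
  also have "\<dots> = card A + (\<Sum>i\<in>A. card (Q i))" by (simp only: sum.distrib) simp
  also have "(\<Sum>i\<in>A. card (Q i)) = card (\<Union>i\<in>A. Q i)"
  proof (rule card_UN_disjoint[symmetric])
    show "\<forall>i\<in>A. \<forall>k\<in>A. i \<noteq> k \<longrightarrow> Q i \<inter> Q k = {}"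
    proof (intro ballI impI, rule ccontr)
      fix i k assume "i \<noteq> k" "Q i \<inter> Q k \<noteq> {}"
      then obtain p where "p \<subseteq> N i" "p \<subseteq> N k" "card p = 2" by (auto simp: Q_def)
      then obtain j l where "j \<noteq> l" "{(i, j), (i, l), (k, j), (k, l)} \<subseteq> E"
        by (auto simp: card_2_iff N_def)
      then show False using \<open>i \<noteq> k\<close> assms(4) unfolding C4_free_def by blast
    qed
  qed (use assms finQ in auto)
  also have "\<dots> \<le> card {p. p \<subseteq> B \<and> card p = 2}"
    using assms(2) by (intro card_mono) (auto simp: Q_def N_def)
  also have "\<dots> = card B choose 2" using assms(2) by (rule n_subsets)
  finally show ?thesis by simp
qed

lemma zarankiewicz_eqI:
  assumes "E \<subseteq> {1..m} \<times> {1..n}" "C4_free E" "card E = m + (n choose 2)"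
  shows "zarankiewicz m n = m + (n choose 2)"
  unfolding zarankiewicz_def
proof (rule Max_eqI)
  let ?A = "{card E |E. E \<subseteq> {1..m} \<times> {1..n} \<and> C4_free E}"
  show le: "y \<le> m + (n choose 2)" if "y \<in> ?A" for y
    using that C4_free_card_le[of "{1..m}" "{1..n}"] by auto
  then show "finite ?A"
    by (intro finite_subset[of ?A "{..m + (n choose 2)}"]) auto
  show "m + (n choose 2) \<in> ?A"
    using assms by (metis (mono_tags, lifting) mem_Collect_eq)
qed

lemma z_wL_ge:
  assumes "weak_admissible {1..m} {1..n} E1 E2" "card E1 = zarankiewicz m n"
  shows "card E1 + card E2 \<le> z_wL m n"
  unfolding z_wL_def
proof (rule Max_ge)
  let ?C = "{1..m} \<times> {1..n}"
  let ?A = "{card E1 + card E2 |(E1 :: (nat \<times> nat) set) E2.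
    weak_admissible {1..m} {1..n} E1 E2 \<and> card E1 = zarankiewicz m n}"
  \<comment> \<open>Only finitely many graphs live on the grid, so the \<open>Max\<close> in
    \<open>z_wL\<close> is over a finite set.\<close>
  have "?A \<subseteq> (\<lambda>(E1, E2). card E1 + card E2) ` (Pow ?C \<times> Pow (Pow ?C))"
  proof
    fix x assume "x \<in> ?A"
    then obtain E1 :: "(nat \<times> nat) set" and E2
      where x: "x = card E1 + card E2" and adm: "weak_admissible {1..m} {1..n} E1 E2"
      by (elim CollectE exE conjE) (rule that)
    from adm have "E1 \<subseteq> ?C" "E2 \<subseteq> Pow ?C"
      unfolding weak_admissible_def augmented_bipartite_graph_def by blast+
    then show "x \<in> (\<lambda>(E1, E2). card E1 + card E2) ` (Pow ?C \<times> Pow (Pow ?C))"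
      using x by (intro image_eqI[of _ _ "(E1, E2)"]) auto
  qed
  then show "finite ?A" by (rule finite_subset) simp
  show "card E1 + card E2 \<in> ?A" using assms by blast
qed

text \<open>All arcs leave \<open>e0\<close>, and none is a loop. The second arc of a cycle would
  have to leave the head of the first, so there is no cycle at all.\<close>

lemma cond_W2I_single:
  assumes "\<And>e. e \<in> E2 \<Longrightarrow> opposite_cells e \<subseteq> occupied E1 E2 \<Longrightarrow> e = e0"
  shows "cond_W2 E1 E2"
proof -
  have arc: "e = e0" "e' \<noteq> e" if "(e, e') \<in> parcs (dependency_graph E1 E2)" for e e'
    using that assms[of e] by (auto simp: dependency_graph_def)
  have "\<not> pre_digraph.cycle (with_proj (dependency_graph E1 E2)) p" for p
  proof
    assume "pre_digraph.cycle (with_proj (dependency_graph E1 E2)) p"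
    then obtain u where p: "set p \<subseteq> parcs (dependency_graph E1 E2)" "pcas u p u" "p \<noteq> []"
      by (auto simp: pre_digraph.cycle_def pre_digraph.awalk_def cas_with_proj_eq)
    then obtain e e' q where q: "p = (e, e') # q" by (cases p) auto
    then have e: "e = e0" "e' \<noteq> e" using p(1) arc by auto
    then have "q \<noteq> []" using p q by auto
    then obtain f f' q' where "q = (f, f') # q'" by (cases q) auto
    then have "f = e'" "f = e0" using p q arc by auto
    then show False using e by simp
  qed
  then show ?thesis by (simp add: cond_W2_def)
qed

section \<open>The augmented incidence graph of the complete graph on six vertices\<close>

text \<open>An edge of the complete graph is an increasing pair rather than a set, so that
  \<open>simp\<close> decides equality of rows. \<open>K6_halves\<close> orders the halves of each
  2-edge for the same purpose.\<close>

definition K6_rows :: "(nat \<times> nat) set" where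
  "K6_rows = {(0,1), (0,2), (0,3), (0,4), (0,5), (1,2), (1,3), (1,4), (1,5), (2,3), (2,4), (2,5),
    (3,4), (3,5), (4,5)}"

definition K6_E1 :: "((nat \<times> nat) \<times> nat) set" where
  "K6_E1 = Sigma K6_rows (\<lambda>(a, b). {a, b})"

definition K6_halves :: "(((nat \<times> nat) \<times> nat) \<times> (nat \<times> nat) \<times> nat) set" where
  "K6_halves = {
    (((0,1), 2), ((3,5), 4)), (((0,1), 3), ((4,5), 2)),
    (((0,2), 1), ((3,4), 5)), (((0,2), 3), ((1,4), 5)),
    (((0,4), 3), ((1,5), 2)), (((0,4), 5), ((1,2), 3)),
    (((0,5), 3), ((2,4), 1)), (((0,5), 4), ((2,3), 1)),
    (((1,3), 0), ((2,4), 5)), (((1,4), 2), ((3,5), 0)),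
    (((1,5), 4), ((2,3), 0)), (((2,5), 1), ((3,4), 0)),
    (((0,3), 5), ((2,5), 4)), (((1,3), 2), ((0,3), 4))}"

definition K6_E2 :: "((nat \<times> nat) \<times> nat) set set" where
  "K6_E2 = (\<lambda>(c, d). {c, d}) ` K6_halves"

definition K6_occupied :: "nat \<times> nat \<Rightarrow> nat \<Rightarrow> bool" where
  "K6_occupied r v \<longleftrightarrow> v = fst r \<or> v = snd r \<or> (r, v) \<in> fst ` K6_halves \<or> (r, v) \<in> snd ` K6_halves"

text \<open>Refuting \<open>K6_occupied\<close> at a cell shows that the cell is unoccupied; this is
  how (W2) and (W3) are checked.\<close>

lemma K6_occupiedD:
  assumes "(r, v) \<in> occupied K6_E1 K6_E2"
  shows "K6_occupied r v"
  using assms unfolding occupied_def K6_E1_def K6_E2_def K6_occupied_def by force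

text \<open>The occupancy matrix row by row, as a lookup table for the finite checks.\<close>

lemma K6_occupied_simps:
  "K6_occupied (0, 1) v \<longleftrightarrow> v \<in> {0, 1, 2, 3}"
  "K6_occupied (0, 2) v \<longleftrightarrow> v \<in> {0, 1, 2, 3}"
  "K6_occupied (0, 3) v \<longleftrightarrow> v \<in> {0, 3, 4, 5}"
  "K6_occupied (0, 4) v \<longleftrightarrow> v \<in> {0, 3, 4, 5}"
  "K6_occupied (0, 5) v \<longleftrightarrow> v \<in> {0, 3, 4, 5}"
  "K6_occupied (1, 2) v \<longleftrightarrow> v \<in> {1, 2, 3}"
  "K6_occupied (1, 3) v \<longleftrightarrow> v \<in> {0, 1, 2, 3}"
  "K6_occupied (1, 4) v \<longleftrightarrow> v \<in> {1, 2, 4, 5}"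
  "K6_occupied (1, 5) v \<longleftrightarrow> v \<in> {1, 2, 4, 5}"
  "K6_occupied (2, 3) v \<longleftrightarrow> v \<in> {0, 1, 2, 3}"
  "K6_occupied (2, 4) v \<longleftrightarrow> v \<in> {1, 2, 4, 5}"
  "K6_occupied (2, 5) v \<longleftrightarrow> v \<in> {1, 2, 4, 5}"
  "K6_occupied (3, 4) v \<longleftrightarrow> v \<in> {0, 3, 4, 5}"
  "K6_occupied (3, 5) v \<longleftrightarrow> v \<in> {0, 3, 4, 5}"
  "K6_occupied (4, 5) v \<longleftrightarrow> v \<in> {2, 4, 5}"
  by (auto simp: K6_occupied_def K6_halves_def)

lemma K6_E2E:
  assumes "e \<in> K6_E2"
  obtains r v s w where "e = {(r, v), (s, w)}" "((r, v), (s, w)) \<in> K6_halves"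
  using assms unfolding K6_E2_def by fast

lemma K6_rowsD: "(a, b) \<in> K6_rows \<Longrightarrow> a < b \<and> b < 6"
  by (auto simp: K6_rows_def)

section \<open>Checking the conditions of weak admissibility\<close>

lemma K6_graph: "augmented_bipartite_graph K6_rows {..<6} K6_E1 K6_E2"
  unfolding augmented_bipartite_graph_def
proof (intro conjI ballI)
  show "finite K6_rows" by (simp add: K6_rows_def)
  show "K6_E1 \<subseteq> K6_rows \<times> {..<6}"
    by (auto simp: K6_E1_def dest: K6_rowsD)
  have *: "\<forall>((r, v), (s, w))\<in>K6_halves. r \<in> K6_rows \<and> s \<in> K6_rows \<and> v < 6 \<and> w < 6 \<and> r \<noteq> s"
    unfolding K6_halves_def K6_rows_def by simp
  fix e assume "e \<in> K6_E2"
  then obtain r v s w where e: "e = {(r, v), (s, w)}" "((r, v), (s, w)) \<in> K6_halves"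
    by (rule K6_E2E)
  then have "r \<in> K6_rows \<and> s \<in> K6_rows \<and> v < 6 \<and> w < 6 \<and> r \<noteq> s"
    using bspec[OF * e(2)] by simp
  then show "e \<subseteq> K6_rows \<times> {..<6}" "card e = 2"
    by (simp_all add: e(1))
qed simp

text \<open>Two distinct vertices are the ends of a single edge, and that edge is a single
  increasing pair.\<close>

lemma K6_C4_free: "C4_free K6_E1"
  unfolding C4_free_def
proof (intro notI, elim exE conjE)
  fix r s and j l :: nat
  assume ne: "r \<noteq> s" "j \<noteq> l" and sub: "{(r, j), (r, l), (s, j), (s, l)} \<subseteq> K6_E1"
  obtain a b c d where rs: "r = (a, b)" "s = (c, d)" by (cases r; cases s)
  have "{j, l} \<subseteq> {a, b}" "{j, l} \<subseteq> {c, d}" "a < b" "c < d"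
    using sub by (auto simp: rs K6_E1_def dest: K6_rowsD)
  then show False using ne by (auto simp: rs)
qed

lemma K6_cond_S: "cond_S K6_E1 K6_E2"
proof -
  have disj: "\<forall>(c, d)\<in>K6_halves. \<forall>(c', d')\<in>K6_halves.
      (c, d) = (c', d') \<or> c \<noteq> c' \<and> c \<noteq> d' \<and> d \<noteq> c' \<and> d \<noteq> d'"
    unfolding K6_halves_def by simp
  have E1: "\<forall>(c, d)\<in>K6_halves. c \<notin> K6_E1 \<and> d \<notin> K6_E1"
    unfolding K6_halves_def K6_E1_def by simp
  have "e \<inter> K6_E1 = {} \<and> (\<forall>f\<in>K6_E2. f \<noteq> e \<longrightarrow> e \<inter> f = {})" if mem: "e \<in> K6_E2" for e
  proof (intro conjI ballI impI)
    obtain r v s w where e: "e = {(r, v), (s, w)}" "((r, v), (s, w)) \<in> K6_halves"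
      using mem by (rule K6_E2E)
    show "e \<inter> K6_E1 = {}"
      using bspec[OF E1 e(2)] by (simp add: e(1))
    fix f assume "f \<in> K6_E2" "f \<noteq> e"
    then obtain t u t' u' where f: "f = {(t, u), (t', u')}" "((t, u), (t', u')) \<in> K6_halves"
      by (elim K6_E2E)
    show "e \<inter> f = {}"
      using bspec[OF bspec[OF disj e(2), unfolded prod.case] f(2)] \<open>f \<noteq> e\<close>
      by (auto simp: e(1) f(1))
  qed
  then show ?thesis
    unfolding cond_S_def by simp
qed

text \<open>The exceptional 2-edge is (03,5;25,4): its opposite cells are the 1-edge (25,5) and the
  half (03,4) of (13,2;03,4). Every other 2-edge has an unoccupied opposite cell.\<close>

lemma K6_cond_W2: "cond_W2 K6_E1 K6_E2"
proof (rule cond_W2I_single)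
  have single: "\<forall>((r, v), (s, w))\<in>K6_halves. K6_occupied r w \<and> K6_occupied s v \<longrightarrow>
      {(r, v), (s, w)} = {((0,3), 5), ((2,5), 4)}"
    \<comment> \<open>Rewriting 1 to \<open>Suc 0\<close> would keep the entries of the table from
      matching.\<close>
    unfolding K6_halves_def by (simp add: K6_occupied_simps del: One_nat_def)
  fix e assume "e \<in> K6_E2" and opp: "opposite_cells e \<subseteq> occupied K6_E1 K6_E2"
  from this(1) obtain r v s w where e: "e = {(r, v), (s, w)}" "((r, v), (s, w)) \<in> K6_halves"
    by (rule K6_E2E)
  then have "K6_occupied r w" "K6_occupied s v"
    using opp by (auto intro: K6_occupiedD)
  then show "e = {((0,3), 5), ((2,5), 4)}"
    using bspec[OF single e(2)] e(1) by simp
qed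

lemma K6_cond_W2': "cond_W2' K6_E1 K6_E2"
proof -
  have E1: "\<forall>((r, v), (s, w))\<in>K6_halves. \<not> ((r, w) \<in> K6_E1 \<and> (s, v) \<in> K6_E1)"
    unfolding K6_halves_def K6_E1_def by simp
  have "\<not> opposite_cells e \<subseteq> K6_E1" if mem: "e \<in> K6_E2" for e
  proof -
    obtain r v s w where e: "e = {(r, v), (s, w)}" "((r, v), (s, w)) \<in> K6_halves"
      using mem by (rule K6_E2E)
    then show ?thesis using bspec[OF E1 e(2)] by simp
  qed
  then show ?thesis
    unfolding cond_W2'_def by blast
qed

text \<open>A finite check against the table: a 2-edge and a 1-edge have the four opposite cells of
  \<open>w3_1\<close>, two 2-edges the eight of \<open>w3_2\<close>. The inequalities there spell
  out vertex-disjointness.\<close>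

lemma K6_cond_W3: "cond_W3 K6_E1 K6_E2"
proof -
  have w3_1: "\<forall>((r, v), (s, w))\<in>K6_halves. \<forall>t\<in>K6_rows. \<forall>u\<in>{fst t, snd t}.
      r \<noteq> t \<and> s \<noteq> t \<and> v \<noteq> u \<and> w \<noteq> u \<longrightarrow>
      \<not> (K6_occupied r u \<and> K6_occupied s u \<and> K6_occupied t v \<and> K6_occupied t w)"
    unfolding K6_halves_def K6_rows_def by (simp add: K6_occupied_simps del: One_nat_def)
  have w3_2: "\<forall>((r, v), (s, w))\<in>K6_halves. \<forall>((t, u), (t', u'))\<in>K6_halves.
      r \<noteq> t \<and> s \<noteq> t \<and> v \<noteq> u \<and> w \<noteq> u \<and> r \<noteq> t' \<and> s \<noteq> t' \<and> v \<noteq> u' \<and> w \<noteq> u' \<longrightarrow>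
      \<not> (K6_occupied r u \<and> K6_occupied s u \<and> K6_occupied t v \<and> K6_occupied t w \<and>
        K6_occupied r u' \<and> K6_occupied s u' \<and> K6_occupied t' v \<and> K6_occupied t' w)"
    unfolding K6_halves_def by (simp add: K6_occupied_simps del: One_nat_def)
  show ?thesis
    unfolding cond_W3_def
  proof (intro ballI impI)
    fix e f
    assume "e \<in> K6_E2" and f: "f \<in> edges K6_E1 K6_E2" and vd: "vertex_disjoint e f"
    from this(1) obtain r v s w where e: "e = {(r, v), (s, w)}" "((r, v), (s, w)) \<in> K6_halves"
      by (rule K6_E2E)
    from f consider t u where "f = {(t, u)}" "t \<in> K6_rows" "u \<in> {fst t, snd t}"
      | t u t' u' where "f = {(t, u), (t', u')}" "((t, u), (t', u')) \<in> K6_halves"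
      by (auto simp: edges_def K6_E1_def K6_E2_def)
    then have "\<not> pair_opposite_cells e f \<subseteq> occupied K6_E1 K6_E2"
    proof cases
      case (1 t u)
      show ?thesis
      proof
        assume occ: "pair_opposite_cells e f \<subseteq> occupied K6_E1 K6_E2"
        have "{(r, u), (s, u), (t, v), (t, w)} \<subseteq> pair_opposite_cells e f"
          unfolding e(1) 1(1) pair_opposite_cells_def by simp
        then have "K6_occupied r u \<and> K6_occupied s u \<and> K6_occupied t v \<and> K6_occupied t w"
          using subset_trans[OF _ occ] by (auto intro: K6_occupiedD)
        moreover have "r \<noteq> t \<and> s \<noteq> t \<and> v \<noteq> u \<and> w \<noteq> u"
          using vd by (auto simp: vertex_disjoint_def e(1) 1(1))
        ultimately show False
          using bspec[OF bspec[OF bspec[OF w3_1 e(2), unfolded prod.case] 1(2)] 1(3)] by blast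
      qed
    next
      case (2 t u t' u')
      show ?thesis
      proof
        assume occ: "pair_opposite_cells e f \<subseteq> occupied K6_E1 K6_E2"
        have "{(r, u), (s, u), (t, v), (t, w), (r, u'), (s, u'), (t', v), (t', w)}
            \<subseteq> pair_opposite_cells e f"
          unfolding e(1) 2(1) pair_opposite_cells_def by simp
        then have "K6_occupied r u \<and> K6_occupied s u \<and> K6_occupied t v \<and> K6_occupied t w \<and>
            K6_occupied r u' \<and> K6_occupied s u' \<and> K6_occupied t' v \<and> K6_occupied t' w"
          using subset_trans[OF _ occ] by (auto intro: K6_occupiedD)
        moreover have "r \<noteq> t \<and> s \<noteq> t \<and> v \<noteq> u \<and> w \<noteq> u \<and>
            r \<noteq> t' \<and> s \<noteq> t' \<and> v \<noteq> u' \<and> w \<noteq> u'"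
          using vd by (auto simp: vertex_disjoint_def e(1) 2(1))
        ultimately show False
          using bspec[OF bspec[OF w3_2 e(2), unfolded prod.case] 2(2)] by simp
      qed
    qed
    then show "\<exists>c\<in>pair_opposite_cells e f. c \<notin> occupied K6_E1 K6_E2" by blast
  qed
qed

lemma K6_weak_admissible: "weak_admissible K6_rows {..<6} K6_E1 K6_E2"
  unfolding weak_admissible_def
  using K6_graph K6_cond_S K6_C4_free K6_cond_W2 K6_cond_W2' K6_cond_W3 by blast

section \<open>Cardinalities and the passage to two-element sets\<close>

lemma card_K6_rows: "card K6_rows = 15"
  by (simp add: K6_rows_def)

lemma card_K6_E1: "card K6_E1 = 30"
proof -
  have "card K6_E1 = (\<Sum>r\<in>K6_rows. card {fst r, snd r})"
    unfolding K6_E1_def by (subst card_SigmaI) (auto simp: K6_rows_def)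
  also have "\<dots> = (\<Sum>r\<in>K6_rows. 2)"
    by (intro sum.cong) (auto simp: K6_rows_def)
  finally show ?thesis by (simp add: card_K6_rows)
qed

lemma card_K6_E2: "card K6_E2 = 14"
  by (simp add: K6_E2_def K6_halves_def doubleton_eq_iff)

lemma lessThan_6: "{..<6} = {0, 1, 2, 3, 4, 5 :: nat}"
  by auto

lemma K6_rowsI:
  assumes "a < b" "b < 6"
  shows "(a, b) \<in> K6_rows"
proof -
  have "a \<in> {0, 1, 2, 3, 4}" "b \<in> {1, 2, 3, 4, 5}"
    using assms by auto
  then show ?thesis
    using assms(1) by (elim insertE emptyE) (simp_all add: K6_rows_def)
qed

lemma K6_rows_image: "(\<lambda>(a, b). {a, b}) ` K6_rows = {e. e \<subseteq> {..<6} \<and> card e = 2}"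
proof (intro equalityI subsetI)
  fix e :: "nat set" assume "e \<in> {e. e \<subseteq> {..<6} \<and> card e = 2}"
  then obtain a b where e: "e = {a, b}" "a \<noteq> b" "a < 6" "b < 6"
    by (auto simp: card_2_iff)
  then consider "(a, b) \<in> K6_rows" | "(b, a) \<in> K6_rows"
    using K6_rowsI by (cases "a < b") auto
  then show "e \<in> (\<lambda>(a, b). {a, b}) ` K6_rows"
    by cases (auto simp: e(1) intro: rev_image_eqI)
qed (auto dest: K6_rowsD)

theorem theorem17:
  fixes S :: "nat set set" and T :: "nat set"
    and E1 :: "(nat set \<times> nat) set" and E2 :: "(nat set \<times> nat) set set"
  assumes "S = {e. e \<subseteq> {0, 1, 2, 3, 4, 5} \<and> card e = 2}"
    and "T = {0, 1, 2, 3, 4, 5}"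
    and "E1 = {(e, v). e \<in> S \<and> v \<in> T \<and> v \<in> e}"
    and "E2 = {
        {({0,1}, 2), ({3,5}, 4)}, {({0,1}, 3), ({4,5}, 2)},
        {({0,2}, 1), ({3,4}, 5)}, {({0,2}, 3), ({1,4}, 5)},
        {({0,4}, 3), ({1,5}, 2)}, {({0,4}, 5), ({1,2}, 3)},
        {({0,5}, 3), ({2,4}, 1)}, {({0,5}, 4), ({2,3}, 1)},
        {({1,3}, 0), ({2,4}, 5)}, {({1,4}, 2), ({3,5}, 0)},
        {({1,5}, 4), ({2,3}, 0)}, {({2,5}, 1), ({3,4}, 0)},
        {({0,3}, 5), ({2,5}, 4)}, {({1,3}, 2), ({0,3}, 4)}}"
  shows "card S = 15 \<and> card E1 = 30 \<and> card E2 = 14 \<and>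
    weak_admissible S T E1 E2 \<and>
    z_wL 15 6 \<ge> card E1 + card E2 \<and> card E1 + card E2 = 44 \<and>
    BSR 15 6 \<ge> 44"
proof -
  define \<phi> :: "nat \<times> nat \<Rightarrow> nat set" where "\<phi> = (\<lambda>(a, b). {a, b})"
  interpret K6: relabelling K6_rows "{..<6}" K6_E1 K6_E2 \<phi> id "map_prod \<phi> id"
    using K6_graph
    by unfold_locales (auto simp: \<phi>_def doubleton_eq_iff inj_on_def dest!: K6_rowsD)
  have S: "S = \<phi> ` K6_rows"
    using K6_rows_image by (simp add: assms(1) \<phi>_def lessThan_6)
  have T: "T = id ` {..<6}"
    by (simp add: assms(2) lessThan_6)
  have K6_E1: "K6_E1 = Sigma K6_rows \<phi>"
    by (simp add: K6_E1_def \<phi>_def)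
  have E1: "E1 = map_prod \<phi> id ` K6_E1"
  proof (intro equalityI subsetI)
    fix c assume "c \<in> E1"
    then obtain r v where "c = (\<phi> r, v)" "r \<in> K6_rows" "v \<in> \<phi> r"
      unfolding assms(3) S by (elim CollectE case_prodE conjE imageE) auto
    then show "c \<in> map_prod \<phi> id ` K6_E1"
      by (intro image_eqI[of _ _ "(r, v)"]) (simp_all add: K6_E1)
  next
    fix c assume "c \<in> map_prod \<phi> id ` K6_E1"
    then obtain r v where c: "c = (\<phi> r, v)" "r \<in> K6_rows" "v \<in> \<phi> r"
      unfolding K6_E1 by (elim imageE SigmaE) auto
    moreover have "\<phi> r \<subseteq> T"
      using c(2) unfolding T \<phi>_def by (cases r) (auto dest: K6_rowsD)
    ultimately show "c \<in> E1"
      unfolding assms(3) S by simp blast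
  qed
  have E2: "E2 = (`) (map_prod \<phi> id) ` K6_E2"
    unfolding assms(4) K6_E2_def K6_halves_def \<phi>_def by simp
  have cards: "card S = 15" "card E1 = 30" "card E2 = 14"
    using card_image[OF K6.inj_\<phi>] K6.card_E1_image K6.card_E2_image
    by (simp_all add: S E1 E2 card_K6_rows card_K6_E1 card_K6_E2)
  have adm: "weak_admissible S T E1 E2"
    unfolding S T E1 E2 by (rule K6.weak_admissible_image[OF K6_weak_admissible])

  \<comment> \<open>\<open>z_wL\<close> and \<open>BSR\<close> refer to initial segments of the
    numbers, so rows and columns are numbered by arbitrary bijections.\<close>
  have "finite S" using cards(1) by (intro card_ge_0_finite) simp
  then obtain f where f: "bij_betw f S {1..15 :: nat}"
    using cards(1) finite_same_card_bij[of S "{1..15 :: nat}"] by auto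
  have "finite T" "card T = 6" by (simp_all add: assms(2))
  then obtain g where g: "bij_betw g T {1..6 :: nat}"
    using finite_same_card_bij[of T "{1..6 :: nat}"] by auto
  interpret nat: relabelling S T E1 E2 f g "map_prod f g"
    using adm f g by unfold_locales (auto simp: weak_admissible_def bij_betw_def)
  define N1 where "N1 = map_prod f g ` E1"
  define N2 where "N2 = (`) (map_prod f g) ` E2"
  have N: "weak_admissible {1..15} {1..6} N1 N2"
    using nat.weak_admissible_image[OF adm] f g by (simp add: N1_def N2_def bij_betw_def)
  have cardN: "card N1 = 30" "card N2 = 14"
    unfolding N1_def N2_def by (simp_all only: nat.card_E1_image nat.card_E2_image cards)
  \<comment> \<open>The general upper bound for 15 rows and 6 columns; \<open>N1\<close> attains it,
    so it has the number of edges that \<open>z_wL\<close> demands.\<close>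
  have choose: "15 + (6 choose 2) = (30 :: nat)"
    by (simp add: choose_two)
  have "zarankiewicz 15 6 = 15 + (6 choose 2)"
    using N cardN(1) choose
    by (intro zarankiewicz_eqI[of N1])
      (auto simp: weak_admissible_def augmented_bipartite_graph_def)
  then have "card N1 + card N2 \<le> z_wL 15 6"
    using N cardN(1) choose by (intro z_wL_ge) auto
  moreover have "card N1 + card N2 \<le> BSR 15 6"
    using N by (rule BSR_ge_card_edges)
  ultimately show ?thesis
    using cards adm cardN by simp
qed

end
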